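(* Let $k\geq 3$ be an integer and let $G$ be a finite simple $2$-degenerate graph with $\Delta(G)\leq 2k$. Then $\chi'_l(G)\leq k$.
   Context: A graph is $2$-degenerate if every subgraph of it has a vertex of degree at most $2$. A linear forest is a forest each of whose components is a path. A $k$-linear coloring of $G$ is a map $c:E(G)\to\{1,\dots,k\}$ such that each color class forms a linear forest. The linear arboricity $\chi'_l(G)$ is the minimum $k$ such that $G$ has a $k$-linear coloring. $\Delta(G)$ is the maximum degree of $G$. *)

theory Defs
  imports "HOL-Library.FuncSet"
begin

text \<open>
  An undirected simple graph is given by a vertex set \<open>V\<close> and a set \<open>E\<close> of two-element
  subsets of \<open>V\<close>. Finiteness of \<open>V\<close> is not built in. The empty graph is allowed.
\<close>

definition simple_graph :: "'a set \<Rightarrow> 'a set set \<Rightarrow> bool" where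
  "simple_graph V E \<longleftrightarrow> (\<forall>e\<in>E. e \<subseteq> V \<and> card e = 2)"

definition subgraph :: "'a set \<Rightarrow> 'a set set \<Rightarrow> 'a set \<Rightarrow> 'a set set \<Rightarrow> bool" where
  "subgraph V' E' V E \<longleftrightarrow> V' \<subseteq> V \<and> E' \<subseteq> E \<and> simple_graph V' E'"

definition degree :: "'a set set \<Rightarrow> 'a \<Rightarrow> nat" where
  "degree E v = card {e \<in> E. v \<in> e}"

text \<open>The inserted \<open>0\<close> only matters for the graph without vertices.\<close>

definition max_degree :: "'a set \<Rightarrow> 'a set set \<Rightarrow> nat" where
  "max_degree V E = Max (insert 0 (degree E ` V))"

text \<open>The subgraph without vertices has to be excluded, as it has no vertex at all.\<close>

definition degenerate :: "nat \<Rightarrow> 'a set \<Rightarrow> 'a set set \<Rightarrow> bool" where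
  "degenerate d V E \<longleftrightarrow>
     (\<forall>V' E'. subgraph V' E' V E \<and> V' \<noteq> {} \<longrightarrow> (\<exists>v\<in>V'. degree E' v \<le> d))"

definition path_graph :: "'a set \<Rightarrow> 'a set set \<Rightarrow> bool" where
  "path_graph V E \<longleftrightarrow>
     (\<exists>vs. vs \<noteq> [] \<and> distinct vs \<and> V = set vs \<and>
           E = {{vs ! i, vs ! Suc i} | i. Suc i < length vs})"

definition cycle_graph :: "'a set \<Rightarrow> 'a set set \<Rightarrow> bool" where
  "cycle_graph V E \<longleftrightarrow>
     (\<exists>vs. length vs \<ge> 3 \<and> distinct vs \<and> V = set vs \<and>
           E = {{vs ! i, vs ! (Suc i mod length vs)} | i. i < length vs})"

definition forest :: "'a set \<Rightarrow> 'a set set \<Rightarrow> bool" where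
  "forest V E \<longleftrightarrow> simple_graph V E \<and> \<not> (\<exists>V' E'. subgraph V' E' V E \<and> cycle_graph V' E')"

definition connected_graph :: "'a set \<Rightarrow> 'a set set \<Rightarrow> bool" where
  "connected_graph V E \<longleftrightarrow>
     V \<noteq> {} \<and> (\<forall>u\<in>V. \<forall>v\<in>V. (\<lambda>x y. {x, y} \<in> E)\<^sup>*\<^sup>* u v)"

definition component :: "'a set \<Rightarrow> 'a set set \<Rightarrow> 'a set \<Rightarrow> 'a set set \<Rightarrow> bool" where
  "component V' E' V E \<longleftrightarrow>
     subgraph V' E' V E \<and> connected_graph V' E' \<and>
     (\<forall>V'' E''. subgraph V'' E'' V E \<and> connected_graph V'' E'' \<and> subgraph V' E' V'' E''
        \<longrightarrow> V'' = V' \<and> E'' = E')"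

definition linear_forest :: "'a set \<Rightarrow> 'a set set \<Rightarrow> bool" where
  "linear_forest V E \<longleftrightarrow>
     forest V E \<and> (\<forall>V' E'. component V' E' V E \<longrightarrow> path_graph V' E')"

text \<open>
  A color class is viewed as a spanning subgraph; vertices that it does not touch are
  one-vertex path components.
\<close>

definition linear_coloring :: "nat \<Rightarrow> 'a set \<Rightarrow> 'a set set \<Rightarrow> ('a set \<Rightarrow> nat) \<Rightarrow> bool" where
  "linear_coloring k V E c \<longleftrightarrow>
     c \<in> E \<rightarrow> {1..k} \<and> (\<forall>i\<in>{1..k}. linear_forest V {e \<in> E. c e = i})"

definition linear_arboricity :: "'a set \<Rightarrow> 'a set set \<Rightarrow> nat" where
  "linear_arboricity V E = (LEAST k. \<exists>c. linear_coloring k V E c)"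

text \<open>
  The minimum in the definition of \<open>linear_arboricity\<close> exists for every finite simple graph:
  coloring the edges injectively gives a linear coloring.
\<close>

lemma linear_forest_single_edge:
  assumes "simple_graph V {e}"
  shows "linear_forest V {e}"
proof -
  have "\<not> cycle_graph V' E'" if s: "subgraph V' E' V {e}" for V' E'
  proof
    assume "cycle_graph V' E'"
    then obtain vs where vs: "length vs \<ge> 3" "distinct vs"
      and E': "E' = {{vs ! i, vs ! (Suc i mod length vs)} | i. i < length vs}"
      unfolding cycle_graph_def by blast
    have "{vs ! 0, vs ! (Suc 0 mod length vs)} \<in> E'"
      unfolding E' using vs by (intro CollectI exI[of _ 0]) auto
    moreover have "{vs ! 1, vs ! (Suc 1 mod length vs)} \<in> E'"
      unfolding E' using vs by (intro CollectI exI[of _ 1]) auto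
    ultimately have "{vs ! 0, vs ! 1} = {vs ! 1, vs ! 2}"
      using s vs by (auto simp: subgraph_def numeral_2_eq_2)
    then have "vs ! 0 = vs ! 2"
      unfolding doubleton_eq_iff by argo
    moreover have "0 < length vs" "2 < length vs"
      using vs(1) by linarith+
    ultimately show False
      using nth_eq_iff_index_eq[OF vs(2), of 0 2] by simp
  qed
  moreover have "path_graph V' E'" if "component V' E' V {e}" for V' E'
  proof -
    from that have s: "subgraph V' E' V {e}" and c: "connected_graph V' E'"
      by (auto simp: component_def)
    from c obtain u where u: "u \<in> V'"
      by (auto simp: connected_graph_def)
    from s consider "E' = {}" | "E' = {e}"
      by (auto simp: subgraph_def)
    then show ?thesis
    proof cases
      case 1
      have "v = u" if "v \<in> V'" for v
      proof -
        have "(\<lambda>x y. {x, y} \<in> E')\<^sup>*\<^sup>* u v"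
          using c u that by (auto simp: connected_graph_def)
        then show ?thesis
          by (induction rule: rtranclp_induct) (auto simp: 1)
      qed
      with u have "V' = {u}" by blast
      then show ?thesis
        unfolding path_graph_def using 1 by (intro exI[of _ "[u]"]) auto
    next
      case 2
      with s obtain a b where ab: "e = {a, b}" "a \<noteq> b" "a \<in> V'" "b \<in> V'"
        by (auto simp: subgraph_def simple_graph_def card_2_iff)
      have "v \<in> {a, b}" if "v \<in> V'" for v
      proof -
        have "(\<lambda>x y. {x, y} \<in> E')\<^sup>*\<^sup>* a v"
          using c ab that by (auto simp: connected_graph_def)
        then show ?thesis
          by (induction rule: rtranclp_induct) (use 2 ab(1) in \<open>auto simp: doubleton_eq_iff\<close>)
      qed
      with ab have "V' = {a, b}" by blast
      then show ?thesis
        unfolding path_graph_def using 2 ab(1,2) by (intro exI[of _ "[a, b]"]) simp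
    qed
  qed
  ultimately show ?thesis
    using assms unfolding linear_forest_def forest_def by blast
qed

lemma linear_coloring_exists:
  assumes "finite V" "simple_graph V E"
  shows "\<exists>k c. linear_coloring k V E c"
proof -
  have "E \<subseteq> Pow V"
    using assms(2) by (auto simp: simple_graph_def)
  then have "finite E"
    using assms(1) by (simp add: finite_subset)
  then obtain c where c: "bij_betw c E {1..card E}"
    using finite_same_card_bij[of E "{1..card E}"] by auto
  have "linear_forest V {e \<in> E. c e = i}" if "i \<in> {1..card E}" for i
  proof -
    from that have "i \<in> c ` E"
      using c by (simp add: bij_betw_def)
    then obtain e where e: "e \<in> E" "c e = i"
      by blast
    then have "{e \<in> E. c e = i} = {e}"
      using c by (auto simp: bij_betw_def inj_on_def)
    moreover have "simple_graph V {e}"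
      using assms(2) e by (auto simp: simple_graph_def)
    ultimately show ?thesis
      by (simp add: linear_forest_single_edge)
  qed
  moreover have "c \<in> E \<rightarrow> {1..card E}"
    using c by (auto simp: bij_betw_def)
  ultimately show ?thesis
    unfolding linear_coloring_def by blast
qed

end

theory Submission
  imports Defs
begin

text \<open>
  The coloring is built by induction on the number of vertices. Call a color free at a vertex if
  it occurs there at most once, call a vertex low if its degree is at most 2, and light if it has
  at most two neighbors that are not low. A vertex of degree at most 1 is harmless. Otherwise
  degeneracy, applied to the graph without its light vertices, yields a vertex \<open>x\<close> that has a light
  neighbor \<open>v\<close> and at most two neighbors that are not light.

  Color \<open>G - v\<close>. All neighbors of \<open>v\<close> but \<open>x\<close> and some \<open>y\<close> are low, and the edges to the low ones
  can always be added greedily, up to one exchange. So only the edges to \<open>x\<close> and \<open>y\<close> matter: the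
  coloring extends unless \<open>x\<close> and \<open>y\<close> have the same color \<open>a\<close> as their only free color and are the
  two ends of one \<open>a\<close>-colored path. In that case \<open>x\<close> and \<open>y\<close> have degree \<open>2k \<ge> 6\<close>, so \<open>x\<close> has a
  second light neighbor \<open>w\<close> whose edge to \<open>x\<close> has a color other than \<open>a\<close>. If \<open>w\<close> is low, this edge
  can be recolored with \<open>a\<close>, which frees its old color at \<open>x\<close>. If \<open>w\<close> is adjacent to \<open>v\<close> and not
  low, then \<open>w = y\<close> and the same works at \<open>y\<close> with a low neighbor of \<open>y\<close>. Otherwise uncolor \<open>w\<close> as
  well: now two different colors are free at \<open>x\<close>, and since a path has only two ends, \<open>v\<close> and \<open>w\<close>
  can be reinserted in one of the two orders with one of the two assignments of these colors.
\<close>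

section \<open>Connectivity and degrees in sets of edges\<close>

abbreviation conn :: "'a set set \<Rightarrow> 'a \<Rightarrow> 'a \<Rightarrow> bool" where
  "conn F \<equiv> (\<lambda>a b. {a, b} \<in> F)\<^sup>*\<^sup>*"

lemma conn_sym: "conn F u v \<Longrightarrow> conn F v u"
proof (induction rule: rtranclp_induct)
  case (step y z)
  then have "{z, y} \<in> F" by (simp add: insert_commute)
  with step.IH show ?case by (rule converse_rtranclp_into_rtranclp[rotated])
qed simp

lemma conn_mono: "conn F u v \<Longrightarrow> F \<subseteq> F' \<Longrightarrow> conn F' u v"
  by (erule rtranclp_mono[THEN predicate2D, rotated]) auto

lemma degree_mono: "finite F \<Longrightarrow> F' \<subseteq> F \<Longrightarrow> degree F' v \<le> degree F v"
  unfolding degree_def by (rule card_mono) auto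

lemma degree_empty [simp]: "degree {} v = 0"
  by (simp add: degree_def)

lemma degree_insert:
  assumes "finite F" "e \<notin> F"
  shows "degree (insert e F) v = degree F v + (if v \<in> e then 1 else 0)"
proof -
  have "{f \<in> insert e F. v \<in> f} = (if v \<in> e then insert e {f \<in> F. v \<in> f} else {f \<in> F. v \<in> f})"
    by auto
  then show ?thesis using assms by (simp add: degree_def)
qed

lemma degree_Diff_edge:
  assumes "finite F" "e \<in> F" "v \<in> e"
  shows "degree F v = Suc (degree (F - {e}) v)"
proof -
  have "degree (insert e (F - {e})) v = degree (F - {e}) v + (if v \<in> e then 1 else 0)"
    using assms(1) by (intro degree_insert) auto
  then show ?thesis using assms(2,3) by (metis Suc_eq_plus1 insert_Diff)
qed

lemma conn_degree:
  assumes "finite F" "conn F u v" "u \<noteq> v"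
  shows "degree F u \<ge> 1"
proof -
  obtain w where "{u, w} \<in> F"
    using assms(2,3) by (auto elim: converse_rtranclpE)
  then have "{u, w} \<in> {e \<in> F. u \<in> e}" by simp
  then show ?thesis
    unfolding degree_def using assms(1) by (metis (no_types, lifting) One_nat_def Suc_leI card_gt_0_iff
      empty_iff finite_subset mem_Collect_eq subsetI)
qed

section \<open>Linear forests\<close>

text \<open>Linear forests are grown edge by edge because colorings are extended that way. The side
  conditions say that the new edge joins ends of two different, possibly trivial, paths; in
  particular \<open>{u, v}\<close> cannot already lie in \<open>F\<close>.\<close>

inductive lin_forest :: "'a set set \<Rightarrow> bool" where
  lin_forest_empty: "lin_forest {}"
| lin_forest_insert: "\<lbrakk>lin_forest F; u \<noteq> v; degree F u \<le> 1; degree F v \<le> 1; \<not> conn F u v\<rbrakk> \<Longrightarrow> lin_forest (insert {u, v} F)"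

lemma lin_forest_finite: "lin_forest F \<Longrightarrow> finite F"
  by (induction rule: lin_forest.induct) auto

text \<open>Dropping edges only lowers degrees and connectivity, so the remaining insertions stay
  legal in the same order.\<close>

lemma lin_forest_subset: "lin_forest F \<Longrightarrow> F' \<subseteq> F \<Longrightarrow> lin_forest F'"
proof (induction arbitrary: F' rule: lin_forest.induct)
  case lin_forest_empty
  then show ?case by (simp add: lin_forest.lin_forest_empty)
next
  case (lin_forest_insert F u v)
  show ?case
  proof (cases "{u, v} \<in> F'")
    case False
    with lin_forest_insert show ?thesis by (metis subset_insert)
  next
    case True
    let ?G = "F' - {{u, v}}"
    have sub: "?G \<subseteq> F" using lin_forest_insert.prems by auto
    have fin: "finite F" using lin_forest_insert.hyps(1) by (rule lin_forest_finite)
    have "lin_forest (insert {u, v} ?G)"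
      using lin_forest_insert.IH[OF sub] lin_forest_insert.hyps(2-5) degree_mono[OF fin sub] conn_mono[OF _ sub, of u v]
      by (intro lin_forest.lin_forest_insert) (meson le_trans)+
    with True show ?thesis by (simp add: insert_absorb)
  qed
qed

section \<open>Paths as vertex lists and partitions into paths\<close>

fun path_edges :: "'a list \<Rightarrow> 'a set set" where
  "path_edges (a # b # p) = insert {a, b} (path_edges (b # p))"
| "path_edges _ = {}"

lemma path_edges_Cons: "p \<noteq> [] \<Longrightarrow> path_edges (a # p) = insert {a, hd p} (path_edges p)"
  by (cases p) auto

lemma path_edges_append:
  "p \<noteq> [] \<Longrightarrow> q \<noteq> [] \<Longrightarrow> path_edges (p @ q) = insert {last p, hd q} (path_edges p \<union> path_edges q)"
proof (induction p)
  case (Cons a p)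
  then show ?case by (cases "p = []") (auto simp: path_edges_Cons)
qed simp

lemma path_edges_rev: "path_edges (rev p) = path_edges p"
proof (induction p)
  case (Cons a p)
  then show ?case
    by (cases "p = []") (auto simp: path_edges_append path_edges_Cons last_rev insert_commute)
qed simp

lemma path_edges_conv_nth: "path_edges p = {{p ! i, p ! Suc i} | i. Suc i < length p}"
proof (induction p rule: path_edges.induct)
  case (1 a b p)
  have "{{(a # b # p) ! i, (a # b # p) ! Suc i} | i. Suc i < length (a # b # p)}
      = insert {a, b} {{(b # p) ! i, (b # p) ! Suc i} | i. Suc i < length (b # p)}"
    (is "?L = ?R")
  proof
    show "?L \<subseteq> ?R"
    proof
      fix e assume "e \<in> ?L"
      then obtain i where "e = {(a # b # p) ! i, (a # b # p) ! Suc i}" "Suc i < length (a # b # p)"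
        by blast
      then show "e \<in> ?R" by (cases i) auto
    qed
    show "?R \<subseteq> ?L"
      by (auto intro: exI[of _ 0]) (rule_tac x = "Suc i" in exI, simp)
  qed
  with 1 show ?case by simp
qed auto

lemma path_edges_subset: "e \<in> path_edges p \<Longrightarrow> e \<subseteq> set p"
  by (induction p rule: path_edges.induct) auto

lemma path_edges_card: "distinct p \<Longrightarrow> e \<in> path_edges p \<Longrightarrow> card e = 2"
  by (induction p rule: path_edges.induct) auto

lemma conn_hd_path: "a \<in> set p \<Longrightarrow> conn (path_edges p) (hd p) a"
proof (induction p)
  case (Cons b p)
  show ?case
  proof (cases "a = b")
    case False
    with Cons.prems have a: "a \<in> set p" and p: "p \<noteq> []" by auto
    have "conn (path_edges (b # p)) (hd p) a"
      using Cons.IH[OF a] by (rule conn_mono) (simp add: path_edges_Cons p subset_insertI)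
    moreover have "{b, hd p} \<in> path_edges (b # p)" by (simp add: path_edges_Cons p)
    ultimately show ?thesis by (simp add: converse_rtranclp_into_rtranclp)
  qed simp
qed simp

lemma conn_path: "a \<in> set p \<Longrightarrow> b \<in> set p \<Longrightarrow> conn (path_edges p) a b"
  by (rule rtranclp_trans[OF conn_sym[OF conn_hd_path] conn_hd_path])

text \<open>An inner vertex of the path lies on two different path edges, so its degree in
  \<open>F\<close> is at least 2.\<close>

lemma path_end:
  assumes "distinct p" "u \<in> set p" "finite F" "path_edges p \<subseteq> F" "degree F u \<le> 1"
  shows "u = hd p \<or> u = last p"
proof (rule ccontr)
  assume "\<not> ?thesis"
  then have ne: "u \<noteq> hd p" "u \<noteq> last p" by auto
  obtain q r where p: "p = q @ u # r" using assms(2) by (meson split_list)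
  with ne have q: "q \<noteq> []" and r: "r \<noteq> []" by auto
  have e: "{last q, u} \<in> F" "{u, hd r} \<in> F"
    using assms(4) q r by (auto simp: p path_edges_append path_edges_Cons)
  have d: "last q \<noteq> hd r" "last q \<noteq> u" "hd r \<noteq> u"
    using assms(1) q r unfolding p by (auto dest: last_in_set hd_in_set)
  then have "card {{last q, u}, {u, hd r}} = 2" by (auto simp: doubleton_eq_iff)
  moreover have "card {{last q, u}, {u, hd r}} \<le> degree F u"
    unfolding degree_def using e assms(3) by (intro card_mono) auto
  ultimately show False using assms(5) by simp
qed

text \<open>One-element lists stand for isolated vertices, so that all of \<open>V\<close> is
  covered while they contribute no edge.\<close>

definition path_partition :: "'a set \<Rightarrow> 'a set set \<Rightarrow> 'a list set \<Rightarrow> bool" where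
  "path_partition V F Ps \<longleftrightarrow> (\<forall>p\<in>Ps. p \<noteq> [] \<and> distinct p) \<and>
     (\<forall>p\<in>Ps. \<forall>q\<in>Ps. p \<noteq> q \<longrightarrow> set p \<inter> set q = {}) \<and> \<Union>(set ` Ps) = V \<and> F = \<Union>(path_edges ` Ps)"

lemma path_partition_edge:
  assumes "path_partition V F Ps" "p \<in> Ps" "e \<in> F" "a \<in> e" "a \<in> set p"
  shows "e \<in> path_edges p"
proof -
  obtain q where q: "q \<in> Ps" "e \<in> path_edges q" using assms(1,3) by (auto simp: path_partition_def)
  then have "a \<in> set q" using path_edges_subset assms(4) by blast
  then have "p = q" using assms q by (auto simp: path_partition_def)
  with q show ?thesis by simp
qed

lemma path_partition_conn:
  assumes "path_partition V F Ps" "p \<in> Ps" "conn F a b" "a \<in> set p"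
  shows "b \<in> set p"
  using assms(3,4)
proof (induction rule: rtranclp_induct)
  case (step y z)
  then have "{y, z} \<in> path_edges p" using path_partition_edge[OF assms(1,2) step.hyps(2), of y] by simp
  then show ?case using path_edges_subset by blast
qed

text \<open>The endpoints of an inserted edge lie on different paths, since they are not connected,
  and are ends of these by \<open>path_end\<close>. The two paths, reversed where necessary, are
  concatenated.\<close>

lemma lin_forest_path_partition: "lin_forest F \<Longrightarrow> \<Union>F \<subseteq> V \<Longrightarrow> \<exists>Ps. path_partition V F Ps"
proof (induction rule: lin_forest.induct)
  case lin_forest_empty
  have "path_partition V {} ((\<lambda>v. [v]) ` V)" by (auto simp: path_partition_def)
  then show ?case ..
next
  case (lin_forest_insert F u v)
  then obtain Ps where Ps: "path_partition V F Ps" by auto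
  have fin: "finite F" using lin_forest_insert.hyps(1) by (rule lin_forest_finite)
  obtain p q where p: "p \<in> Ps" "u \<in> set p" and q: "q \<in> Ps" "v \<in> set q"
    using Ps lin_forest_insert.prems by (auto simp: path_partition_def)
  have sub: "path_edges p \<subseteq> F" "path_edges q \<subseteq> F"
    and nn: "p \<noteq> []" "q \<noteq> []" "distinct p" "distinct q"
    using Ps p q by (auto simp: path_partition_def)
  have "p \<noteq> q"
    using lin_forest_insert.hyps(5) conn_mono[OF conn_path sub(1)] p q by blast
  then have disj: "set p \<inter> set q = {}" using Ps p q by (auto simp: path_partition_def)
  have "u = hd p \<or> u = last p" "v = hd q \<or> v = last q"
    using path_end[OF _ _ fin] nn sub p q lin_forest_insert.hyps by auto
  then obtain p' q' where p': "p' = p \<or> p' = rev p" "last p' = u" and q': "q' = q \<or> q' = rev q" "hd q' = v"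
    using nn by (metis hd_rev last_rev)
  let ?r = "p' @ q'"
  have r: "set ?r = set p \<union> set q" "distinct ?r" "?r \<noteq> []"
    using p'(1) q'(1) nn disj by auto
  have "path_edges ?r = insert {u, v} (path_edges p \<union> path_edges q)"
    using p' q' nn by (auto simp: path_edges_append path_edges_rev)
  then have "insert {u, v} F = \<Union>(path_edges ` insert ?r (Ps - {p, q}))"
    using Ps p q by (auto simp: path_partition_def)
  moreover have "\<Union>(set ` insert ?r (Ps - {p, q})) = V"
    using Ps p q r by (auto simp: path_partition_def)
  moreover have "set ?r \<inter> set s = {}" if "s \<in> Ps - {p, q}" for s
    using that Ps p q unfolding r path_partition_def by blast
  moreover have "s \<noteq> [] \<and> distinct s" if "s \<in> Ps" for s
    using that Ps by (auto simp: path_partition_def)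
  moreover have "set s \<inter> set t = {}" if "s \<in> Ps" "t \<in> Ps" "s \<noteq> t" for s t
    using that Ps by (auto simp: path_partition_def)
  ultimately have "path_partition V (insert {u, v} F) (insert ?r (Ps - {p, q}))"
    using r(2,3) unfolding path_partition_def by (metis (no_types, lifting) Diff_iff Int_commute insert_iff)
  then show ?case ..
qed

text \<open>All three vertices would be ends of one path of a partition, which has only two.\<close>

lemma lin_forest_three_ends:
  assumes "lin_forest F" "conn F x y" "conn F x z" "x \<noteq> y" "x \<noteq> z" "y \<noteq> z"
    "degree F x \<le> 1" "degree F y \<le> 1" "degree F z \<le> 1"
  shows False
proof -
  obtain Ps where Ps: "path_partition UNIV F Ps" using lin_forest_path_partition[OF assms(1)] by auto
  then have "x \<in> \<Union>(set ` Ps)" by (simp add: path_partition_def)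
  then obtain p where p: "p \<in> Ps" "x \<in> set p" by blast
  then have "y \<in> set p" "z \<in> set p" using path_partition_conn[OF Ps] assms(2,3) by blast+
  moreover have "path_edges p \<subseteq> F" "distinct p" using Ps p by (auto simp: path_partition_def)
  ultimately have "w = hd p \<or> w = last p" if "w \<in> {x, y, z}" for w
    using path_end[OF _ _ lin_forest_finite[OF assms(1)], of p w] p assms(7-) that by auto
  then show False using assms(4-6) by blast
qed

text \<open>The witness \<open>w\<close> is the first vertex of \<open>p\<close> that lies in
  \<open>W\<close>: inside \<open>W\<close> it can only be joined to its successor on
  \<open>p\<close>. This excludes cycles, where every vertex has two edges.\<close>

lemma path_end_in_subset:
  assumes "distinct p" "W \<noteq> {}" "W \<subseteq> set p"
  shows "\<exists>w\<in>W. \<exists>e0. \<forall>e\<in>path_edges p. w \<in> e \<and> e \<subseteq> W \<longrightarrow> e = e0"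
  using assms
proof (induction p)
  case (Cons a p)
  show ?case
  proof (cases "a \<in> W")
    case True
    have "e = {a, hd p}" if "e \<in> path_edges (a # p)" "a \<in> e" for e
      using that Cons.prems(1) path_edges_subset[of e p] by (cases "p = []") (auto simp: path_edges_Cons)
    with True show ?thesis by blast
  next
    case False
    with Cons.prems have "W \<subseteq> set p" by auto
    with Cons obtain w e0 where w: "w \<in> W" "\<forall>e\<in>path_edges p. w \<in> e \<and> e \<subseteq> W \<longrightarrow> e = e0" by auto
    have "e \<in> path_edges p" if "e \<in> path_edges (a # p)" "e \<subseteq> W" for e
      using that False by (cases "p = []") (auto simp: path_edges_Cons)
    with w show ?thesis by blast
  qed
qed simp

lemma path_partition_no_cycle:
  assumes Ps: "path_partition V F Ps" and sub: "subgraph V' E' V F"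
  shows "\<not> cycle_graph V' E'"
proof
  assume "cycle_graph V' E'"
  then obtain vs where len: "length vs \<ge> 3" and dist: "distinct vs" and V': "V' = set vs"
    and E': "E' = {{vs ! i, vs ! (Suc i mod length vs)} | i. i < length vs}"
    unfolding cycle_graph_def by blast
  let ?n = "length vs"
  have edge: "{vs ! i, vs ! (Suc i mod ?n)} \<in> F" if "i < ?n" for i
    using that sub E' by (auto simp: subgraph_def)
  have "vs ! 0 \<in> set vs" using len by (intro nth_mem) linarith
  then have "vs ! 0 \<in> V" using sub V' by (auto simp: subgraph_def)
  then obtain p where p: "p \<in> Ps" "vs ! 0 \<in> set p" using Ps by (auto simp: path_partition_def)
  have inp: "i < ?n \<Longrightarrow> vs ! i \<in> set p" for i
  proof (induction i)
    case (Suc i)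
    then have "{vs ! i, vs ! Suc i} \<in> F" using edge[of i] by simp
    then have "conn F (vs ! i) (vs ! Suc i)" by (rule r_into_rtranclp)
    with Suc show ?case using path_partition_conn[OF Ps p(1)] by simp
  qed (use p in simp)
  then have "set vs \<subseteq> set p" by (auto simp: in_set_conv_nth)
  moreover have "set vs \<noteq> {}" using len by auto
  moreover have "distinct p" using Ps p by (auto simp: path_partition_def)
  ultimately obtain w e0 where w: "w \<in> set vs"
    and e0: "\<forall>e\<in>path_edges p. w \<in> e \<and> e \<subseteq> set vs \<longrightarrow> e = e0"
    using path_end_in_subset by metis
  obtain i where i: "i < ?n" "w = vs ! i" using w by (auto simp: in_set_conv_nth)
  \<comment> \<open>The cyclic predecessor and successor of \<open>i\<close>. They differ because a
    cycle has at least three vertices, yet both edges at \<open>w\<close> would have to equal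
    \<open>e0\<close>.\<close>
  define j l where "j = (if i = 0 then ?n - 1 else i - 1)" and "l = Suc i mod ?n"
  have j: "j < ?n" "Suc j mod ?n = i" and l: "l < ?n"
    using i len mod_less_divisor[of ?n "Suc i"] by (auto simp: j_def l_def simp del: length_0_conv intro!: mod_less_divisor)
  have ne: "j \<noteq> l" "i \<noteq> l"
    using i len by (auto simp: j_def l_def mod_Suc split: if_splits)
  have "e = e0" if "e \<in> F" "w \<in> e" "e \<subseteq> set vs" for e
    using e0 path_partition_edge[OF Ps p(1) that(1) that(2)] inp i that by blast
  note unique = this
  have "{vs ! i, vs ! l} = e0"
    using edge[OF i(1)] i l unfolding l_def[symmetric] by (intro unique) auto
  moreover have "{vs ! j, vs ! i} = e0"
    using edge[OF j(1)] i j(1) unfolding j(2) by (intro unique) auto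
  ultimately have "vs ! j = vs ! l" by (metis doubleton_eq_iff)
  then show False using ne j l dist by (simp add: nth_eq_iff_index_eq)
qed

text \<open>A component lies inside the path \<open>p\<close> through one of its vertices. As
  \<open>p\<close> is itself a connected subgraph, maximality makes the two equal.\<close>

lemma lin_forest_linear_forest:
  assumes "lin_forest F" "simple_graph V F"
  shows "linear_forest V F"
proof -
  have "\<Union>F \<subseteq> V" using assms(2) by (auto simp: simple_graph_def)
  then obtain Ps where Ps: "path_partition V F Ps" using lin_forest_path_partition[OF assms(1)] by blast
  have "path_graph V' E'" if comp: "component V' E' V F" for V' E'
  proof -
    have sub: "V' \<subseteq> V" "E' \<subseteq> F" "simple_graph V' E'" and con: "connected_graph V' E'"
      using comp by (auto simp: component_def subgraph_def)
    then obtain u where u: "u \<in> V'" by (auto simp: connected_graph_def)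
    with sub obtain p where p: "p \<in> Ps" "u \<in> set p" using Ps by (auto simp: path_partition_def)
    have pp: "p \<noteq> []" "distinct p" "path_edges p \<subseteq> F" "set p \<subseteq> V"
      using Ps p by (auto simp: path_partition_def)
    have V': "V' \<subseteq> set p"
    proof
      fix w assume "w \<in> V'"
      then have "conn E' u w" using con u by (auto simp: connected_graph_def)
      then have "conn F u w" using sub(2) by (rule conn_mono)
      then show "w \<in> set p" using path_partition_conn[OF Ps p(1)] p(2) by blast
    qed
    have E': "E' \<subseteq> path_edges p"
    proof
      fix e assume e: "e \<in> E'"
      then have "e \<subseteq> V'" "card e = 2" using sub(3) by (auto simp: simple_graph_def)
      moreover from this have "e \<noteq> {}" by auto
      ultimately obtain a where "a \<in> e" "a \<in> set p" using V' by blast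
      then show "e \<in> path_edges p" using path_partition_edge[OF Ps p(1)] e sub(2) by blast
    qed
    have simple: "simple_graph (set p) (path_edges p)"
      using path_edges_subset[of _ p] path_edges_card[OF pp(2)] by (auto simp: simple_graph_def)
    have "subgraph (set p) (path_edges p) V F" "subgraph V' E' (set p) (path_edges p)"
      using pp simple V' E' sub by (auto simp: subgraph_def)
    moreover have "connected_graph (set p) (path_edges p)"
      using pp(1) conn_path by (auto simp: connected_graph_def)
    ultimately have "set p = V'" "path_edges p = E'"
      using comp by (auto simp: component_def)
    with pp show ?thesis
      unfolding path_graph_def path_edges_conv_nth by blast
  qed
  with assms(2) path_partition_no_cycle[OF Ps] show ?thesis
    unfolding linear_forest_def forest_def by blast
qed

section \<open>Extending colorings\<close>

lemma lin_forest_degree: "lin_forest F \<Longrightarrow> degree F w \<le> 2"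
proof (induction rule: lin_forest.induct)
  case (lin_forest_insert F u v)
  then show ?case
    using degree_insert[OF lin_forest_finite[OF lin_forest_insert.hyps(1)], of "{u, v}" w]
    by (cases "{u, v} \<in> F") (auto simp: insert_absorb split: if_splits)
qed simp

lemma degree_Un_le: "degree (A \<union> B) v \<le> degree A v + degree B v"
proof -
  have "{e \<in> A \<union> B. v \<in> e} = {e \<in> A. v \<in> e} \<union> {e \<in> B. v \<in> e}" by blast
  then show ?thesis unfolding degree_def by (metis card_Un_le)
qed

definition star :: "'a \<Rightarrow> 'a set \<Rightarrow> 'a set set" where
  "star v U = (\<lambda>u. {v, u}) ` U"

lemma star_insert [simp]: "star v (insert u U) = insert {v, u} (star v U)"
  by (simp add: star_def)

lemma star_empty [simp]: "star v {} = {}"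
  by (simp add: star_def)

lemma mem_star_iff: "{v, w} \<in> star v U \<longleftrightarrow> w \<in> U"
  by (auto simp: star_def doubleton_eq_iff)

lemma degree_star_center: "finite U \<Longrightarrow> degree (star v U) v \<le> card U"
proof -
  assume U: "finite U"
  then have "degree (star v U) v \<le> card (star v U)"
    unfolding degree_def star_def by (intro card_mono) auto
  also have "\<dots> \<le> card U" unfolding star_def using U by (rule card_image_le)
  finally show ?thesis .
qed

lemma degree_star_leaf: "w \<noteq> v \<Longrightarrow> degree (star v U) w \<le> (if w \<in> U then 1 else 0)"
proof -
  assume "w \<noteq> v"
  then have "{e \<in> star v U. w \<in> e} = (if w \<in> U then {{v, w}} else {})"
    by (auto simp: star_def)
  then show ?thesis by (simp add: degree_def)
qed

section \<open>Colorings by linear forests and free colors\<close>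

definition color_class :: "'a set set \<Rightarrow> ('a set \<Rightarrow> nat) \<Rightarrow> nat \<Rightarrow> 'a set set" where
  "color_class E c i = {e \<in> E. c e = i}"

text \<open>Classes of colors outside \<open>{1..k}\<close> are empty, so letting \<open>i\<close>
  range over all numbers avoids side conditions without strengthening the notion.\<close>

definition lin_coloring :: "nat \<Rightarrow> 'a set set \<Rightarrow> ('a set \<Rightarrow> nat) \<Rightarrow> bool" where
  "lin_coloring k E c \<longleftrightarrow> c \<in> E \<rightarrow> {1..k} \<and> (\<forall>i. lin_forest (color_class E c i))"

definition free :: "nat \<Rightarrow> 'a set set \<Rightarrow> ('a set \<Rightarrow> nat) \<Rightarrow> 'a \<Rightarrow> nat \<Rightarrow> bool" where
  "free k E c v i \<longleftrightarrow> i \<in> {1..k} \<and> degree (color_class E c i) v \<le> 1"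

lemma lin_coloring_class: "lin_coloring k E c \<Longrightarrow> lin_forest (color_class E c i)"
  by (simp add: lin_coloring_def)

lemma lin_coloring_Union: "lin_coloring k E c \<Longrightarrow> E = (\<Union>i\<in>{1..k}. color_class E c i)"
  by (auto simp: lin_coloring_def color_class_def)

lemma lin_coloring_finite:
  assumes "lin_coloring k E c"
  shows "finite E"
proof -
  have "finite (\<Union>i\<in>{1..k}. color_class E c i)"
    by (intro finite_UN_I) (simp_all add: lin_forest_finite[OF lin_coloring_class[OF assms]])
  then show ?thesis unfolding lin_coloring_Union[OF assms, symmetric] .
qed

lemma lin_coloring_subset: "lin_coloring k E c \<Longrightarrow> E' \<subseteq> E \<Longrightarrow> lin_coloring k E' c"
proof -
  assume *: "lin_coloring k E c" "E' \<subseteq> E"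
  have "color_class E' c i \<subseteq> color_class E c i" for i using *(2) by (auto simp: color_class_def)
  then have "lin_forest (color_class E' c i)" for i using lin_forest_subset lin_coloring_class[OF *(1)] by blast
  with * show ?thesis by (auto simp: lin_coloring_def)
qed

lemma lin_coloring_add_edge:
  assumes "lin_coloring k E c" "i \<in> {1..k}" "u \<noteq> v" "{u, v} \<notin> E"
    "degree (color_class E c i) u \<le> 1" "degree (color_class E c i) v \<le> 1"
    "\<not> conn (color_class E c i) u v"
  shows "lin_coloring k (insert {u, v} E) (c({u, v} := i))"
proof -
  let ?e = "{u, v}"
  have "color_class (insert ?e E) (c(?e := i)) j
      = (if j = i then insert ?e (color_class E c j) else color_class E c j)" for j
    using assms(4) by (auto simp: color_class_def)
  moreover have "lin_forest (insert ?e (color_class E c i))"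
    using assms by (intro lin_forest_insert) (auto simp: lin_coloring_class)
  ultimately show ?thesis using assms(1,2) by (auto simp: lin_coloring_def)
qed

lemma degree_color_class_le: "finite E \<Longrightarrow> degree (color_class E c i) v \<le> degree E v"
  by (rule degree_mono) (auto simp: color_class_def)

lemma degree_two_color_classes:
  assumes "finite E" "i \<noteq> j"
  shows "degree (color_class E c i) v + degree (color_class E c j) v \<le> degree E v"
proof -
  have "degree (color_class E c i) v + degree (color_class E c j) v
      = card ({e \<in> color_class E c i. v \<in> e} \<union> {e \<in> color_class E c j. v \<in> e})"
    unfolding degree_def using assms by (subst card_Un_disjoint) (auto simp: color_class_def)
  also have "\<dots> \<le> degree E v"
    unfolding degree_def using assms(1) by (intro card_mono) (auto simp: color_class_def)
  finally show ?thesis .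
qed

lemma degree_eq_sum:
  assumes "lin_coloring k E c"
  shows "degree E v = (\<Sum>i\<in>{1..k}. degree (color_class E c i) v)"
proof -
  have "{e \<in> E. v \<in> e} = (\<Union>i\<in>{1..k}. {e \<in> color_class E c i. v \<in> e})"
    using lin_coloring_Union[OF assms] by blast
  then show ?thesis
    unfolding degree_def using lin_coloring_finite[OF assms]
    by (simp only:) (rule card_UN_disjoint, auto simp: color_class_def)
qed

text \<open>If every color occurred at least twice at \<open>v\<close>, the degree would be at least
  \<open>2 * k\<close>.\<close>

lemma free_exists:
  assumes "lin_coloring k E c" "degree E v < 2 * k"
  obtains i where "free k E c v i"
proof -
  have "\<exists>i\<in>{1..k}. degree (color_class E c i) v \<le> 1"
  proof (rule ccontr)
    assume *: "\<not> ?thesis"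
    have "2 \<le> degree (color_class E c i) v" if "i \<in> {1..k}" for i
    proof -
      have "\<not> degree (color_class E c i) v \<le> 1" using * that by blast
      then show ?thesis by linarith
    qed
    then have "(\<Sum>i\<in>{1..k}. 2) \<le> (\<Sum>i\<in>{1..k}. degree (color_class E c i) v)"
      by (intro sum_mono)
    then show False using assms degree_eq_sum[OF assms(1), of v] by simp
  qed
  then show ?thesis using that by (auto simp: free_def)
qed

text \<open>One of the at most two edges at \<open>z\<close> is \<open>{x, z}\<close>, whose color
  is not \<open>a\<close>, so \<open>z\<close> has at most one edge of color \<open>a\<close>. The
  path of color \<open>a\<close> with ends \<open>x\<close> and \<open>y\<close> has no third end,
  so \<open>z\<close> is not on it and \<open>{x, z}\<close> can join it. The old color occurred at
  most twice at \<open>x\<close> and so becomes free there.\<close>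

lemma recolor_edge:
  assumes col: "lin_coloring k E c" and e: "{x, z} \<in> E" and ca: "c {x, z} \<noteq> a" and a: "a \<in> {1..k}"
    and deg: "degree (color_class E c a) x \<le> 1" "degree (color_class E c a) y \<le> 1" "degree E z \<le> 2"
    and ne: "x \<noteq> y" "x \<noteq> z" "y \<noteq> z" and xy: "conn (color_class E c a) x y"
  shows "lin_coloring k E (c({x, z} := a))"
    and "free k E (c({x, z} := a)) x (c {x, z})"
    and "degree (color_class E (c({x, z} := a)) a) y \<le> 1"
proof -
  let ?e = "{x, z}"
  have fin: "finite E" using lin_coloring_finite[OF col] .
  then have finc: "finite (color_class E c i)" for i by (simp add: color_class_def)
  have same: "color_class (E - {?e}) c a = color_class E c a"
    using ca by (auto simp: color_class_def)
  have j: "c ?e \<in> {1..k}" using col e by (auto simp: lin_coloring_def)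
  have mem: "?e \<in> color_class E c (c ?e)" using e by (simp add: color_class_def)
  have "degree (color_class E c (c ?e)) z \<ge> 1"
    using degree_Diff_edge[OF finc mem, of z] by simp
  then have degz: "degree (color_class E c a) z \<le> 1"
    using degree_two_color_classes[OF fin ca, of c z] deg(3) by linarith
  have "\<not> conn (color_class E c a) x z"
    using lin_forest_three_ends[OF lin_coloring_class[OF col] xy _ ne(1,2,3) deg(1,2) degz] by blast
  then have "lin_coloring k (insert ?e (E - {?e})) (c(?e := a))"
    using deg degz same ne a lin_coloring_subset[OF col] by (intro lin_coloring_add_edge) auto
  then show "lin_coloring k E (c(?e := a))" using e by (simp add: insert_absorb)
  have "color_class E (c(?e := a)) (c ?e) = color_class E c (c ?e) - {?e}"
    using ca by (auto simp: color_class_def)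
  then have "degree (color_class E (c(?e := a)) (c ?e)) x \<le> 1"
    using degree_Diff_edge[OF finc mem, of x] lin_forest_degree[OF lin_coloring_class[OF col], of "c ?e" x] by simp
  then show "free k E (c(?e := a)) x (c ?e)" using j by (simp add: free_def)
  have "{f \<in> color_class E (c(?e := a)) a. y \<in> f} = {f \<in> color_class E c a. y \<in> f}"
    using ne by (auto simp: color_class_def)
  then show "degree (color_class E (c(?e := a)) a) y \<le> 1" using deg(2) by (simp add: degree_def)
qed

text \<open>If no free color of \<open>v\<close> can be given to the new edge, then the only free color \<open>i\<close> is also
  the color of the other edge at \<open>u\<close>; some edge \<open>{v, w}\<close> with \<open>w \<in> U\<close> then has another color and
  passes it on to \<open>{v, u}\<close>, receiving \<open>i\<close> in exchange.\<close>

lemma attach_leaf: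
  assumes k: "k \<ge> 3" and col: "lin_coloring k E c" and new: "{v, u} \<notin> E" "u \<noteq> v"
    and degu: "degree E u \<le> 1" and degv: "degree E v < 2 * k"
    and U: "star v U \<subseteq> E" "u \<notin> U" "v \<notin> U" "\<And>w. w \<in> U \<Longrightarrow> degree E w \<le> 2"
    and rest: "degree (E - star v U) v \<le> 2"
  shows "\<exists>c'. lin_coloring k (insert {v, u} E) c' \<and> (\<forall>e\<in>E - star v U. c' e = c e)"
proof -
  have fin: "finite E" using lin_coloring_finite[OF col] .
  then have finc: "finite (color_class E c i)" for i by (simp add: color_class_def)
  have degcu: "degree (color_class E c i) u \<le> 1" for i
    using degree_color_class_le[OF fin] degu le_trans by blast
  show ?thesis
  proof (cases "\<exists>i. free k E c v i \<and> \<not> conn (color_class E c i) v u")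
    case True
    then obtain i where i: "free k E c v i" "\<not> conn (color_class E c i) v u" by blast
    then have "lin_coloring k (insert {v, u} E) (c({v, u} := i))"
      using col new degcu by (intro lin_coloring_add_edge) (auto simp: free_def)
    moreover have "\<forall>e\<in>E - star v U. (c({v, u} := i)) e = c e" using new(1) by auto
    ultimately show ?thesis by blast
  next
    case False
    obtain i where i: "free k E c v i" using free_exists[OF col degv] .
    then have con: "conn (color_class E c i) v u" using False by blast
    then have degi: "degree (color_class E c i) u \<ge> 1"
      using conn_degree[OF finc conn_sym] new(2) by metis
    \<comment> \<open>The only edge at \<open>u\<close> has color \<open>i\<close>. In all other
      classes \<open>u\<close> is isolated, so those colors cannot close a cycle and, by the case
      assumption, none of them is free at \<open>v\<close>.\<close>
    have degj: "degree (color_class E c j) u = 0" if "j \<noteq> i" for j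
      using degree_two_color_classes[OF fin that, of c u] degi degu by linarith
    have nconn: "\<not> conn F v u" if "degree F u = 0" "finite F" for F
      using conn_degree[OF that(2) conn_sym] that(1) new(2) by fastforce
    have two: "degree (color_class E c j) v \<ge> 2" if "j \<in> {1..k}" "j \<noteq> i" for j
    proof -
      have "\<not> free k E c v j" using False nconn[OF degj[OF that(2)] finc] by blast
      then have "\<not> degree (color_class E c j) v \<le> 1" using that(1) unfolding free_def by blast
      then show ?thesis by linarith
    qed
    obtain w where w: "w \<in> U" "c {v, w} \<noteq> i"
    proof (rule ccontr)
      assume "\<not> thesis"
      then have all: "c e = i" if "e \<in> star v U" for e
        using that \<open>\<And>w. w \<in> U \<Longrightarrow> c {v, w} \<noteq> i \<Longrightarrow> thesis\<close> by (auto simp: star_def)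
      \<comment> \<open>As \<open>k \<ge> 3\<close>, there are two colors besides \<open>i\<close>.
        Each occurs twice at \<open>v\<close>, and if the star had color \<open>i\<close> only,
        these four edges would lie outside it, where \<open>v\<close> has at most two.\<close>
      have "\<exists>j1 j2. j1 \<in> {1..k} \<and> j2 \<in> {1..k} \<and> j1 \<noteq> i \<and> j2 \<noteq> i \<and> j1 \<noteq> j2"
        using k by (intro exI[of _ "if i = 1 then 2 else 1"] exI[of _ "if i = 3 then 2 else 3"]) auto
      then obtain j1 j2 where j: "j1 \<in> {1..k}" "j2 \<in> {1..k}" "j1 \<noteq> i" "j2 \<noteq> i" "j1 \<noteq> j2"
        by blast
      have "color_class (E - star v U) c j = color_class E c j" if "j \<noteq> i" for j
        using that all by (auto simp: color_class_def)
      then have "4 \<le> degree (E - star v U) v"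
        using degree_two_color_classes[of "E - star v U" j1 j2 c v] two[of j1] two[of j2] j fin by simp
      then show False using rest by simp
    qed
    let ?c = "c({v, w} := i)" and ?j = "c {v, w}"
    have vw: "{v, w} \<in> E" using w U(1) by (auto simp: star_def)
    have wne: "v \<noteq> w" "u \<noteq> w" using w U by auto
    \<comment> \<open>Here \<open>v\<close>, \<open>w\<close>, \<open>u\<close> play the roles of
      \<open>x\<close>, \<open>z\<close>, \<open>y\<close>.\<close>
    note rec = recolor_edge[OF col vw w(2) _ _ degcu U(4)[OF w(1)] new(2)[symmetric] wne con]
    have iv: "i \<in> {1..k}" "degree (color_class E c i) v \<le> 1" using i by (auto simp: free_def)
    have col': "lin_coloring k E ?c" and fr: "free k E ?c v ?j" using rec iv by auto
    have "degree (color_class E ?c ?j) u \<le> degree (color_class E c ?j) u"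
      using w(2) by (intro degree_mono finc) (auto simp: color_class_def split: if_splits)
    then have z: "degree (color_class E ?c ?j) u = 0" using degj[OF w(2)] by simp
    have "lin_coloring k (insert {v, u} E) (?c({v, u} := ?j))"
      using fr z nconn[OF z lin_forest_finite[OF lin_coloring_class[OF col']]] new
      by (intro lin_coloring_add_edge[OF col']) (auto simp: free_def)
    moreover have "\<forall>e\<in>E - star v U. (?c({v, u} := ?j)) e = c e"
      using w(1) new(1) by (auto simp: star_def)
    ultimately show ?thesis by blast
  qed
qed

text \<open>The leaves are added one at a time by \<open>attach_leaf\<close>. Its exchanges recolor
  only edges from \<open>v\<close> to earlier leaves, so the colors on \<open>E\<close> survive; the
  bound on \<open>card U\<close> leaves a free color at \<open>v\<close> each time.\<close>

lemma attach_leaves: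
  assumes k: "k \<ge> 3" and col: "lin_coloring k E c" and "finite U" and "v \<notin> U" and "star v U \<inter> E = {}"
    and "\<And>u. u \<in> U \<Longrightarrow> degree E u \<le> 1" and "degree E v \<le> 2" and "degree E v + card U \<le> 2 * k"
  shows "\<exists>c'. lin_coloring k (E \<union> star v U) c' \<and> (\<forall>e\<in>E. c' e = c e)"
  using assms(3-6,8)
proof (induction U rule: finite_induct)
  case empty
  then show ?case using col by auto
next
  case (insert u U)
  then obtain c' where c': "lin_coloring k (E \<union> star v U) c'" "\<forall>e\<in>E. c' e = c e" by auto
  let ?E = "E \<union> star v U"
  have fin: "finite E" using lin_coloring_finite[OF col] .
  have degw: "degree ?E w \<le> (if w = u then 1 else 2)" if "w \<in> insert u U" for w
    using degree_Un_le[of E "star v U" w] degree_star_leaf[of w v U] insert.prems(1,3) that insert.hyps(2)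
    by (fastforce split: if_splits)
  have "degree ?E v < 2 * k"
    using degree_Un_le[of E "star v U" v] degree_star_center[OF insert.hyps(1), of v] insert.prems(4) insert.hyps
    by simp
  moreover have "degree (?E - star v U) v \<le> 2"
    using degree_mono[OF fin, of "?E - star v U" v] assms(7) by fastforce
  moreover have "{v, u} \<notin> ?E"
    using insert.prems(2) insert.hyps(2) by (auto simp: mem_star_iff)
  moreover have "u \<noteq> v" "v \<notin> U" using insert.prems(1) by auto
  moreover have "degree ?E u \<le> 1" using degw[of u] by simp
  moreover have "degree ?E w \<le> 2" if "w \<in> U" for w
    using degw[of w] that by (simp split: if_splits)
  ultimately obtain c'' where c'': "lin_coloring k (insert {v, u} ?E) c''" "\<forall>e\<in>?E - star v U. c'' e = c' e"
    using attach_leaf[OF k c'(1), of v u U] insert.hyps(2) by blast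
  have "\<forall>e\<in>E. c'' e = c e"
  proof
    fix e assume e: "e \<in> E"
    then have "e \<in> ?E - star v U" using insert.prems(2) by auto
    with e show "c'' e = c e" using c''(2) c'(2) by simp
  qed
  with c''(1) show ?case by auto
qed

section \<open>Reinserting one or two deleted vertices\<close>

lemma conn_insert_pendant:
  assumes "v \<notin> \<Union>F" "conn (insert {v, x} F) v y" "y \<noteq> v"
  shows "conn F x y"
proof -
  have "y = v \<or> conn F x y"
    using assms(2)
  proof (induction rule: rtranclp_induct)
    case (step y z)
    show ?case
    proof (cases "{y, z} = {v, x}")
      case True
      then show ?thesis by (auto simp: doubleton_eq_iff)
    next
      case False
      then have "{y, z} \<in> F" using step.hyps(2) by simp
      moreover from this have "y \<noteq> v" using assms(1) by auto
      ultimately show ?thesis using step.IH by (auto intro: rtranclp.rtrancl_into_rtrancl)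
    qed
  qed simp
  with assms(3) show ?thesis by simp
qed

text \<open>The isolated vertex \<open>v\<close> is to be joined to \<open>x\<close>,
  \<open>y\<close> and all of \<open>U\<close>. Afterwards \<open>v\<close> has degree at most
  \<open>2 * k\<close>, and the vertices of \<open>U\<close> have degree at most 2.\<close>

definition attachable :: "nat \<Rightarrow> 'a set set \<Rightarrow> 'a \<Rightarrow> 'a \<Rightarrow> 'a \<Rightarrow> 'a set \<Rightarrow> bool" where
  "attachable k E v x y U \<longleftrightarrow> v \<notin> \<Union>E \<and> x \<noteq> y \<and> v \<noteq> x \<and> v \<noteq> y \<and> finite U \<and> x \<notin> U \<and> y \<notin> U \<and>
     v \<notin> U \<and> card U + 2 \<le> 2 * k \<and> (\<forall>u\<in>U. degree E u \<le> 1)"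

text \<open>The edge to \<open>x\<close> is pendant when added. The edge to \<open>y\<close> then
  closes a cycle only if \<open>a = b\<close> and this color already connects \<open>x\<close> and
  \<open>y\<close>. The leaves follow without changing these two colors, which the conclusion
  records for attaching a second vertex.\<close>

lemma attach_vertex:
  assumes k: "k \<ge> 3" and col: "lin_coloring k E c" and at: "attachable k E v x y U"
    and fr: "free k E c x a" "free k E c y b" and ok: "a \<noteq> b \<or> \<not> conn (color_class E c a) x y"
  shows "\<exists>c'. lin_coloring k (E \<union> star v (insert x (insert y U))) c' \<and> (\<forall>e\<in>E. c' e = c e) \<and>
    c' {v, x} = a \<and> c' {v, y} = b"
proof -
  have v: "v \<notin> \<Union>E" and ne: "x \<noteq> y" "v \<noteq> x" "v \<noteq> y"
    and U: "finite U" "x \<notin> U" "y \<notin> U" "v \<notin> U" "card U + 2 \<le> 2 * k" "\<And>u. u \<in> U \<Longrightarrow> degree E u \<le> 1"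
    using at by (auto simp: attachable_def)
  have nv: "{v, w} \<notin> E" for w using v by auto
  have fin: "finite E" using lin_coloring_finite[OF col] .
  then have finc: "finite (color_class E c i)" for i by (simp add: color_class_def)
  have vc: "v \<notin> \<Union>(color_class E c i)" for i using v by (auto simp: color_class_def)
  have deg0: "degree F v = 0" if "v \<notin> \<Union>F" for F
  proof -
    have "{e \<in> F. v \<in> e} = {}" using that by auto
    then show ?thesis unfolding degree_def by (simp only: card.empty)
  qed
  have "\<not> conn (color_class E c a) v x"
    using conn_degree[OF finc, of a v x] deg0[OF vc] ne by auto
  then have col1: "lin_coloring k (insert {v, x} E) (c({v, x} := a))"
    using col fr(1) ne nv deg0[OF vc[of a]] by (intro lin_coloring_add_edge) (auto simp: free_def)
  let ?E1 = "insert {v, x} E" and ?c1 = "c({v, x} := a)"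
  have cc1: "color_class ?E1 ?c1 b = (if b = a then insert {v, x} (color_class E c b) else color_class E c b)"
    using nv by (auto simp: color_class_def)
  have xe: "{v, x} \<notin> color_class E c b" using nv by (auto simp: color_class_def)
  have "\<not> conn (color_class ?E1 ?c1 b) v y"
  proof (cases "b = a")
    case True
    then have "\<not> conn (color_class E c b) x y" using ok by simp
    then show ?thesis using conn_insert_pendant[OF vc[of b], of x y] ne unfolding cc1 using True by auto
  next
    case False
    then show ?thesis using conn_degree[OF finc, of b v y] deg0[OF vc, of b] ne unfolding cc1 by auto
  qed
  moreover have "degree (color_class ?E1 ?c1 b) v \<le> 1" "degree (color_class ?E1 ?c1 b) y \<le> 1"
    using degree_insert[OF finc xe] deg0[OF vc[of b]] fr(2) ne unfolding cc1 by (auto simp: free_def)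
  moreover have "{v, y} \<notin> ?E1" using nv ne by (auto simp: doubleton_eq_iff)
  ultimately have col2: "lin_coloring k (insert {v, y} ?E1) (?c1({v, y} := b))"
    using col1 fr(2) ne by (intro lin_coloring_add_edge[OF col1]) (auto simp: free_def)
  let ?E2 = "insert {v, y} ?E1" and ?c2 = "?c1({v, y} := b)"
  have d2: "degree ?E2 w = degree E w + (if w = x \<or> w = v then 1 else 0) + (if w = y \<or> w = v then 1 else 0)" for w
    using degree_insert[of ?E1 "{v, y}" w] degree_insert[of E "{v, x}" w] fin nv ne
    by (auto simp: doubleton_eq_iff)
  have "star v U \<inter> ?E2 = {}"
    using nv U(2,3) by (auto simp: star_def doubleton_eq_iff)
  moreover have "degree ?E2 u \<le> 1" if "u \<in> U" for u
    using U that d2[of u] by auto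
  ultimately obtain c' where c': "lin_coloring k (?E2 \<union> star v U) c'" "\<forall>e\<in>?E2. c' e = ?c2 e"
    using attach_leaves[OF k col2 U(1,4)] d2[of v] deg0[OF v] U(5) by auto
  have "?E2 \<union> star v U = E \<union> star v (insert x (insert y U))" by auto
  moreover have "c' {v, x} = a" "c' {v, y} = b" "\<forall>e\<in>E. c' e = c e"
    using c'(2) nv ne by (auto simp: doubleton_eq_iff)
  ultimately show ?thesis using c'(1) by auto
qed

text \<open>\<open>v1\<close> goes first, with colors \<open>s\<close> and \<open>b1\<close>. For
  \<open>v2\<close>, the condition \<open>t \<noteq> b2\<close> rules out a cycle, so only the
  freeness of \<open>t\<close> and \<open>b2\<close> and the degrees in \<open>U2\<close> have to
  survive; \<open>common\<close> and \<open>yy\<close> ensure this at shared neighbors.\<close>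

lemma attach_two_ordered:
  assumes k: "k \<ge> 3" and col: "lin_coloring k E c"
    and at1: "attachable k E v1 x y1 U1" and at2: "attachable k E v2 x y2 U2"
    and vv: "v1 \<noteq> v2" "v1 \<notin> insert y2 U2" "v2 \<notin> insert y1 U1"
    and common: "\<And>u. u \<in> insert y1 U1 \<Longrightarrow> u \<in> insert y2 U2 \<Longrightarrow> u \<in> U1 \<union> U2 \<Longrightarrow> degree E u = 0"
    and yy: "y1 = y2 \<Longrightarrow> b1 = b2 \<Longrightarrow> degree (color_class E c b1) y1 = 0"
    and fr: "free k E c x s" "free k E c x t" "free k E c y1 b1" "free k E c y2 b2"
    and st: "s \<noteq> t" and ok: "s \<noteq> b1 \<or> \<not> conn (color_class E c s) x y1" "t \<noteq> b2"
  shows "\<exists>c'. lin_coloring k (E \<union> star v1 (insert x (insert y1 U1)) \<union> star v2 (insert x (insert y2 U2))) c'"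
proof -
  let ?E1 = "E \<union> star v1 (insert x (insert y1 U1))"
  obtain c1 where c1: "lin_coloring k ?E1 c1" "\<forall>e\<in>E. c1 e = c e" "c1 {v1, x} = s" "c1 {v1, y1} = b1"
    using attach_vertex[OF k col at1 fr(1,3) ok(1)] by blast
  have fin: "finite ?E1" "finite E" using lin_coloring_finite c1(1) col by blast+
  have ne: "x \<noteq> y1" "v1 \<noteq> x" "x \<notin> U1" "y1 \<notin> U1" "x \<noteq> y2" "v2 \<noteq> x" "v1 \<noteq> y2" "v1 \<notin> U2" "v2 \<notin> \<Union>E"
    "x \<notin> U2" "v1 \<noteq> y1"
    using at1 at2 vv by (auto simp: attachable_def)
  have edges: "{e \<in> color_class ?E1 c1 i. w \<in> e} \<subseteq> {e \<in> color_class E c i. w \<in> e} \<union>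
      (if w \<in> insert x (insert y1 U1) \<and> c1 {v1, w} = i then {{v1, w}} else {})" if "w \<noteq> v1" for w i
    using c1(2) that by (auto simp: color_class_def star_def)
  have finc: "finite {e \<in> color_class E c i. w \<in> e}" for w i using fin(2) by (simp add: color_class_def)
  have same: "degree (color_class ?E1 c1 i) w \<le> degree (color_class E c i) w"
    if "w \<noteq> v1" "w \<in> insert x (insert y1 U1) \<Longrightarrow> c1 {v1, w} \<noteq> i" for w i
    using edges[OF that(1), of i] that(2) unfolding degree_def by (intro card_mono finc) (auto split: if_splits)
  have degE1: "degree ?E1 w \<le> degree E w + (if w \<in> insert x (insert y1 U1) then 1 else 0)" if "w \<noteq> v1" for w
    using degree_Un_le[of E "star v1 (insert x (insert y1 U1))" w] degree_star_leaf[OF that, of "insert x (insert y1 U1)"]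
    by linarith
  have frx: "free k ?E1 c1 x t"
    using fr(2) same[of x t] ne c1(3) st by (auto simp: free_def)
  have "degree (color_class ?E1 c1 b2) y2 \<le> 1"
  proof -
    \<comment> \<open>Only in the first case can the class of \<open>b2\<close> gain an edge at
      \<open>y2\<close> that matters: \<open>yy\<close> says that the color was absent there. If
      \<open>y2\<close> is a leaf of \<open>v1\<close>, then \<open>common\<close> makes its total
      degree at most 1.\<close>
    consider "y2 = y1" "b1 = b2" | "y2 = y1" "b1 \<noteq> b2" | "y2 \<in> U1" | "y2 \<notin> insert y1 U1" by blast
    then show ?thesis
    proof cases
      case 1
      have "card {e \<in> color_class ?E1 c1 b2. y2 \<in> e} \<le> card (insert {v1, y2} {e \<in> color_class E c b2. y2 \<in> e})"
        using edges[of y2 b2] ne by (intro card_mono) (auto simp: finc split: if_splits)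
      also have "\<dots> \<le> Suc (card {e \<in> color_class E c b2. y2 \<in> e})" by (rule card_insert_le_m1) auto
      finally show ?thesis using yy 1 by (simp add: degree_def)
    next
      case 2
      then show ?thesis using same[of y2 b2] ne c1(4) fr(4) by (auto simp: free_def)
    next
      case 3
      then show ?thesis
        using degE1[of y2] common[of y2] ne degree_color_class_le[OF fin(1), of c1 b2 y2] by simp
    next
      case 4
      then show ?thesis using same[of y2 b2] ne fr(4) by (auto simp: free_def)
    qed
  qed
  then have fry: "free k ?E1 c1 y2 b2" using fr(4) by (simp add: free_def)
  have "degree ?E1 u \<le> 1" if "u \<in> U2" for u
  proof -
    have "u \<noteq> v1" "u \<noteq> x" "degree E u \<le> 1" using that ne at2 by (auto simp: attachable_def)
    then show ?thesis using degE1[of u] common[of u] that by (cases "u \<in> insert y1 U1") auto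
  qed
  moreover have "v2 \<notin> \<Union>?E1" using ne vv by (auto simp: star_def)
  ultimately have "attachable k ?E1 v2 x y2 U2" using at2 by (auto simp: attachable_def)
  then show ?thesis using attach_vertex[OF k c1(1) _ frx fry] ok(2) by blast
qed

text \<open>Exchanging the two vertices or the colors \<open>s\<close> and \<open>t\<close> gives
  four ways to use \<open>attach_two_ordered\<close>. One of them succeeds because a path has only
  two ends.\<close>

lemma attach_two_vertices:
  assumes k: "k \<ge> 3" and col: "lin_coloring k E c"
    and at1: "attachable k E v1 x y1 U1" and at2: "attachable k E v2 x y2 U2"
    and vv: "v1 \<noteq> v2" "v1 \<notin> insert y2 U2" "v2 \<notin> insert y1 U1"
    and common: "\<And>u. u \<in> insert y1 U1 \<Longrightarrow> u \<in> insert y2 U2 \<Longrightarrow> u \<in> U1 \<union> U2 \<Longrightarrow> degree E u = 0"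
    and yy: "y1 = y2 \<Longrightarrow> b1 = b2 \<Longrightarrow> degree (color_class E c b1) y1 = 0"
    and fr: "free k E c x s" "free k E c x t" "free k E c y1 b1" "free k E c y2 b2"
    and st: "s \<noteq> t"
  shows "\<exists>c'. lin_coloring k (E \<union> star v1 (insert x (insert y1 U1)) \<union> star v2 (insert x (insert y2 U2))) c'"
proof -
  let ?G = "E \<union> star v1 (insert x (insert y1 U1)) \<union> star v2 (insert x (insert y2 U2))"
  have swap: "E \<union> star v2 (insert x (insert y2 U2)) \<union> star v1 (insert x (insert y1 U1)) = ?G" by auto
  have finc: "finite (color_class E c i)" for i using lin_forest_finite lin_coloring_class[OF col] by blast
  have 12: "\<exists>c'. lin_coloring k ?G c'" if "free k E c x p" "free k E c x q" "p \<noteq> q"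
      "p \<noteq> b1 \<or> \<not> conn (color_class E c p) x y1" "q \<noteq> b2" for p q
    by (rule attach_two_ordered[OF k col at1 at2 vv common yy that(1,2) fr(3,4) that(3-5)])
  have 21: "\<exists>c'. lin_coloring k ?G c'" if "free k E c x p" "free k E c x q" "p \<noteq> q"
      "p \<noteq> b2 \<or> \<not> conn (color_class E c p) x y2" "q \<noteq> b1" for p q
    by (subst swap[symmetric], rule attach_two_ordered[OF k col at2 at1 vv(1)[symmetric] vv(3,2) _ _ that(1,2) fr(4,3) that(3-5)])
      (use common yy in auto)
  have ne: "x \<noteq> y1" "x \<noteq> y2" using at1 at2 by (auto simp: attachable_def)
  have not_both: "\<not> conn (color_class E c p) x y1 \<or> \<not> conn (color_class E c p) x y2"
    if "free k E c x p" "b1 = p" "b2 = p" for p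
  proof (cases "y1 = y2")
    case True
    then have "degree (color_class E c p) y1 = 0" using yy that by simp
    then have "\<not> conn (color_class E c p) y1 x" using conn_degree[OF finc, of p y1 x] ne by auto
    then show ?thesis using conn_sym by metis
  next
    case False
    then show ?thesis
      using lin_forest_three_ends[OF lin_coloring_class[OF col], of p x y1 y2] ne that fr(3,4) by (auto simp: free_def)
  qed
  \<comment> \<open>If neither of the first two cases holds, \<open>b1\<close> and \<open>b2\<close>
    are the same one of \<open>s\<close> and \<open>t\<close>. By \<open>not_both\<close> that color
    fails to connect \<open>x\<close> to \<open>y1\<close> or to \<open>y2\<close>; the
    corresponding vertex goes first and uses it at \<open>x\<close>.\<close>
  consider "s \<noteq> b1" "t \<noteq> b2" | "t \<noteq> b1" "s \<noteq> b2" | "b1 = s" "b2 = s" | "b1 = t" "b2 = t" using st by blast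
  then show ?thesis
  proof cases
    case 1
    then show ?thesis using 12[of s t] fr st by auto
  next
    case 2
    then show ?thesis using 12[of t s] fr st by auto
  next
    case 3
    then show ?thesis using not_both[of s] 12[of s t] 21[of s t] fr st by auto
  next
    case 4
    then show ?thesis using not_both[of t] 12[of t s] 21[of t s] fr st by auto
  qed
qed

section \<open>Neighborhoods and vertex deletion\<close>

definition neighbors :: "'a set set \<Rightarrow> 'a \<Rightarrow> 'a set" where
  "neighbors E v = {w. {v, w} \<in> E}"

definition del_vertex :: "'a set set \<Rightarrow> 'a \<Rightarrow> 'a set set" where
  "del_vertex E v = {e \<in> E. v \<notin> e}"

lemma neighbors_sym: "w \<in> neighbors E v \<longleftrightarrow> v \<in> neighbors E w"
  by (simp add: neighbors_def insert_commute)

lemma simple_edge_neq: "simple_graph V E \<Longrightarrow> {v, w} \<in> E \<Longrightarrow> v \<noteq> w"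
  by (auto simp: simple_graph_def)

lemma simple_graph_subset: "simple_graph V E \<Longrightarrow> E' \<subseteq> E \<Longrightarrow> simple_graph V E'"
  by (auto simp: simple_graph_def)

lemma bij_betw_neighbors:
  assumes "simple_graph V E"
  shows "bij_betw (\<lambda>w. {v, w}) (neighbors E v) {e \<in> E. v \<in> e}"
proof -
  have "\<exists>w. e = {v, w}" if "e \<in> E" "v \<in> e" for e
  proof -
    have "card e = 2" using assms that(1) by (auto simp: simple_graph_def)
    then obtain a b where "e = {a, b}" by (auto simp: card_2_iff)
    with that(2) show ?thesis by auto
  qed
  then show ?thesis
    by (auto simp: bij_betw_def inj_on_def neighbors_def doubleton_eq_iff image_def)
qed

lemma degree_eq_card_neighbors: "simple_graph V E \<Longrightarrow> degree E v = card (neighbors E v)"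
  unfolding degree_def by (rule bij_betw_same_card[OF bij_betw_neighbors, symmetric])

lemma finite_neighbors: "simple_graph V E \<Longrightarrow> finite E \<Longrightarrow> finite (neighbors E v)"
  by (simp add: bij_betw_finite[OF bij_betw_neighbors])

lemma del_vertex_subset: "del_vertex E v \<subseteq> E"
  by (auto simp: del_vertex_def)

lemma del_vertex_Un_star:
  assumes "simple_graph V E"
  shows "E = del_vertex E v \<union> star v (neighbors E v)"
proof -
  have "star v (neighbors E v) = {e \<in> E. v \<in> e}"
    using bij_betw_neighbors[OF assms, of v] by (simp add: bij_betw_def star_def)
  then show ?thesis by (auto simp: del_vertex_def)
qed

lemma neighbors_del_vertex: "w \<noteq> v \<Longrightarrow> neighbors (del_vertex E v) w = neighbors E w - {v}"
  by (auto simp: neighbors_def del_vertex_def)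

lemma degree_del_vertex:
  assumes "simple_graph V E" "finite E" "u \<in> neighbors E v"
  shows "degree E u = Suc (degree (del_vertex E v) u)"
proof -
  have "u \<noteq> v" using assms(3) simple_edge_neq[OF assms(1), of v u] by (auto simp: neighbors_def)
  then have "degree (del_vertex E v) u = card (neighbors E u - {v})"
    using degree_eq_card_neighbors[OF simple_graph_subset[OF assms(1) del_vertex_subset]] neighbors_del_vertex by metis
  moreover have "v \<in> neighbors E u" using assms(3) neighbors_sym by metis
  ultimately show ?thesis
    using degree_eq_card_neighbors[OF assms(1), of u] card_Suc_Diff1[OF finite_neighbors[OF assms(1,2)]] by metis
qed

lemma free_subset:
  assumes "lin_coloring k E c" "free k E c w i" "E' \<subseteq> E"
  shows "free k E' c w i"
proof -
  have "degree (color_class E' c i) w \<le> degree (color_class E c i) w"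
    using assms by (intro degree_mono lin_forest_finite lin_coloring_class) (auto simp: color_class_def)
  with assms(2) show ?thesis by (simp add: free_def)
qed

lemma degree_color_class_removed:
  assumes "lin_coloring k E c" "e \<in> E" "w \<in> e" "E' \<subseteq> E - {e}"
  shows "Suc (degree (color_class E' c (c e)) w) \<le> degree (color_class E c (c e)) w"
proof -
  have fin: "finite (color_class E c (c e))" using lin_forest_finite lin_coloring_class assms(1) by blast
  have "degree (color_class E' c (c e)) w \<le> degree (color_class E c (c e) - {e}) w"
    using assms(4) fin by (intro degree_mono) (auto simp: color_class_def)
  then show ?thesis using degree_Diff_edge[OF fin, of e w] assms by (simp add: color_class_def)
qed

lemma free_removed:
  assumes "lin_coloring k E c" "e \<in> E" "w \<in> e" "E' \<subseteq> E - {e}"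
  shows "free k E' c w (c e)"
proof -
  have "c e \<in> {1..k}" using assms(1,2) by (auto simp: lin_coloring_def)
  moreover have "degree (color_class E' c (c e)) w \<le> 1"
    using degree_color_class_removed[OF assms] lin_forest_degree[OF lin_coloring_class[OF assms(1)], of "c e" w] by linarith
  ultimately show ?thesis by (simp add: free_def)
qed

text \<open>Every color except \<open>a\<close> contributes at least 2 to the degree, and
  \<open>a\<close> contributes at least 1.\<close>

lemma degree_unique_free:
  assumes "lin_coloring k E c" "a \<in> {1..k}" "degree (color_class E c a) v \<ge> 1" "\<And>i. free k E c v i \<Longrightarrow> i = a"
  shows "2 * k \<le> Suc (degree E v)"
proof -
  have "(\<Sum>i\<in>{1..k} - {a}. 2) \<le> (\<Sum>i\<in>{1..k} - {a}. degree (color_class E c i) v)"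
  proof (rule sum_mono)
    fix i assume i: "i \<in> {1..k} - {a}"
    then have "\<not> free k E c v i" using assms(4) by blast
    with i have "\<not> degree (color_class E c i) v \<le> 1" by (auto simp: free_def)
    then show "2 \<le> degree (color_class E c i) v" by linarith
  qed
  then show ?thesis
    using degree_eq_sum[OF assms(1), of v] sum.remove[of "{1..k}" a "\<lambda>i. degree (color_class E c i) v"] assms(2,3)
    by simp
qed

section \<open>Light vertices\<close>

text \<open>Vertices outside the graph have degree 0 and count as low, so
  \<open>low E = UNIV\<close> expresses that all vertices are low.\<close>

definition low :: "'a set set \<Rightarrow> 'a set" where
  "low E = {v. degree E v \<le> 2}"

definition light :: "'a set set \<Rightarrow> 'a set" where
  "light E = {v. card (neighbors E v - low E) \<le> 2}"

text \<open>A neighbor of \<open>v\<close> that is neither low nor \<open>x\<close> is taken as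
  \<open>y\<close> if there is one. Then \<open>x\<close> is not low either, and the two exhaust the
  neighbors that are not low. Otherwise any second neighbor will do.\<close>

lemma light_second_neighbor:
  assumes "simple_graph V E" "finite E" "v \<in> light E" "degree E v \<ge> 2" "x \<in> neighbors E v"
    and "x \<notin> low E \<or> low E = UNIV"
  obtains y where "y \<noteq> x" "y \<in> neighbors E v" "neighbors E v - {x, y} \<subseteq> low E"
proof (cases "neighbors E v - low E - {x} = {}")
  case True
  have "neighbors E v \<noteq> {x}" using assms(4) degree_eq_card_neighbors[OF assms(1), of v] by auto
  then obtain y where "y \<in> neighbors E v" "y \<noteq> x" using assms(5) by blast
  with True that show ?thesis by blast
next
  case False
  then obtain y where y: "y \<in> neighbors E v" "y \<notin> low E" "y \<noteq> x" by blast
  with assms(6) have x: "x \<notin> low E" by blast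
  have "neighbors E v - low E = {x, y}"
  proof (rule sym, rule card_seteq)
    show "finite (neighbors E v - low E)" using finite_neighbors[OF assms(1,2)] by simp
    show "{x, y} \<subseteq> neighbors E v - low E" using x y assms(5) by blast
    show "card (neighbors E v - low E) \<le> card {x, y}" using assms(3) y(3) by (simp add: light_def)
  qed
  with y that show ?thesis by blast
qed

text \<open>The heart of the induction. The condition \<open>min\<close> admits degree 0 because
  \<open>w\<close> also ranges over elements outside the graph.\<close>

lemma extend_at_light_vertex:
  assumes k: "k \<ge> 3" and simple: "simple_graph V E" and fin: "finite E"
    and max: "\<And>w. degree E w \<le> 2 * k" and min: "\<And>w. degree E w \<noteq> 0 \<Longrightarrow> degree E w \<ge> 2"
    and x: "card (neighbors E x - light E) \<le> 2" "x \<notin> low E \<or> low E = UNIV"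
    and v1: "v1 \<in> neighbors E x" "v1 \<in> light E"
    and col: "lin_coloring k (del_vertex E v1) c"
  shows "\<exists>c'. lin_coloring k E c'"
proof -
  let ?E1 = "del_vertex E v1"
  have nb: "v \<noteq> w \<and> degree E v \<ge> 2" if "w \<in> neighbors E v" for v w
  proof -
    have "card (neighbors E v) \<noteq> 0" using that finite_neighbors[OF simple fin, of v] by auto
    then show ?thesis
      using min[of v] degree_eq_card_neighbors[OF simple, of v] simple_edge_neq[OF simple] that
      by (auto simp: neighbors_def)
  qed
  have xv1: "x \<in> neighbors E v1" using v1(1) neighbors_sym by metis
  obtain y where y: "y \<noteq> x" "y \<in> neighbors E v1" "neighbors E v1 - {x, y} \<subseteq> low E"
    using light_second_neighbor[OF simple fin v1(2) _ xv1 x(2)] nb[OF xv1] by blast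
  define U1 where "U1 = neighbors E v1 - {x, y}"
  have N1: "neighbors E v1 = insert x (insert y U1)" using xv1 y(2) by (auto simp: U1_def)
  have leaf: "degree (del_vertex E v) u \<le> 1" if "u \<in> neighbors E v" "u \<in> low E" for u v
    using degree_del_vertex[OF simple fin that(1)] that(2) by (simp add: low_def)
  have cardU: "card (neighbors E v - {p, q}) + 2 \<le> 2 * k" if "p \<noteq> q" "p \<in> neighbors E v" "q \<in> neighbors E v" for p q v
  proof -
    have f: "finite (neighbors E v)" using finite_neighbors[OF simple fin] .
    then have "card {p, q} \<le> card (neighbors E v)" using that by (intro card_mono) auto
    then show ?thesis
      using that max[of v] degree_eq_card_neighbors[OF simple, of v] f by (simp add: card_Diff_subset)
  qed
  have at1: "attachable k ?E1 v1 x y U1"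
    using y xv1 nb[OF xv1] nb[OF y(2)] cardU[OF y(1)[symmetric] xv1 y(2)] leaf finite_neighbors[OF simple fin]
      nb[of v1 v1]
    by (auto simp: attachable_def U1_def del_vertex_def)
  then have at1': "attachable k ?E1 v1 y x U1" by (auto simp: attachable_def)
  have E: "?E1 \<union> star v1 (insert x (insert y U1)) = E" "?E1 \<union> star v1 (insert y (insert x U1)) = E"
    using del_vertex_Un_star[OF simple, of v1] N1 by (simp_all add: insert_commute)
  have fr: "\<exists>i. free k ?E1 c w i" if "w \<in> neighbors E v1" for w
    using free_exists[OF col, of w] degree_del_vertex[OF simple fin that] max[of w] by (metis Suc_le_lessD)
  show ?thesis
  proof (cases "\<exists>i j. free k ?E1 c x i \<and> free k ?E1 c y j \<and> (i \<noteq> j \<or> \<not> conn (color_class ?E1 c i) x y)")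
    case True
    then show ?thesis using attach_vertex[OF k col at1] unfolding E by blast
  next
    case False
    obtain a where a: "free k ?E1 c x a" using fr[OF xv1] by blast
    obtain b where b: "free k ?E1 c y b" using fr[OF y(2)] by blast
    have ya: "free k ?E1 c y a" using a b False by blast
    \<comment> \<open>A free color at \<open>x\<close> and a different one at \<open>y\<close>, or a
      common one not connecting them, would have been the previous case.\<close>
    have con: "conn (color_class ?E1 c a) x y" and ux: "\<And>i. free k ?E1 c x i \<Longrightarrow> i = a"
      and uy: "\<And>i. free k ?E1 c y i \<Longrightarrow> i = a"
      using a ya False by blast+
    have ak: "a \<in> {1..k}" and da: "degree (color_class ?E1 c a) x \<le> 1" "degree (color_class ?E1 c a) y \<le> 1"
      using a ya by (auto simp: free_def)
    have finc: "finite (color_class ?E1 c a)" using lin_forest_finite[OF lin_coloring_class[OF col]] .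
    have dega: "degree (color_class ?E1 c a) x \<ge> 1" "degree (color_class ?E1 c a) y \<ge> 1"
      using conn_degree[OF finc con] conn_degree[OF finc conn_sym[OF con]] y(1) by auto
    \<comment> \<open>The unique free color yields degree at least \<open>2 * k - 1\<close> after
      the deletion, and the edge to \<open>v1\<close> adds one.\<close>
    have degx: "degree E x \<ge> 2 * k" and degy: "degree E y \<ge> 2 * k"
      using degree_unique_free[OF col ak dega(1) ux] degree_unique_free[OF col ak dega(2) uy]
        degree_del_vertex[OF simple fin xv1] degree_del_vertex[OF simple fin y(2)] by simp_all
    then have xlow: "x \<notin> low E" and ylow: "y \<notin> low E" using k by (auto simp: low_def)
    \<comment> \<open>Giving \<open>{p, z}\<close> the color \<open>a\<close> frees its old color at
      \<open>p\<close>. Then \<open>v1\<close> is attached with that color at \<open>p\<close> and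
      with \<open>a\<close> at \<open>q\<close>.\<close>
    have recolor: "\<exists>c'. lin_coloring k E c'"
      if "(p, q) = (x, y) \<or> (p, q) = (y, x)" "z \<in> neighbors E p" "z \<noteq> v1" "z \<in> low E" "c {p, z} \<noteq> a" for p q z
    proof -
      have pv: "p \<noteq> v1" using that(1) nb[OF xv1] nb[OF y(2)] by auto
      have pz: "{p, z} \<in> ?E1" using that(2,3) pv by (auto simp: neighbors_def del_vertex_def)
      have pq: "p \<noteq> q" "p \<noteq> z" "q \<noteq> z" using that(1,4) y(1) nb[OF that(2)] xlow ylow by auto
      have dpq: "degree (color_class ?E1 c a) p \<le> 1" "degree (color_class ?E1 c a) q \<le> 1"
        "conn (color_class ?E1 c a) p q"
        using that(1) da con conn_sym[OF con] by auto
      have "degree ?E1 z \<le> 2"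
        using degree_mono[OF fin del_vertex_subset, of v1 z] that(4) by (simp add: low_def)
      note rec = recolor_edge[OF col pz that(5) ak dpq(1,2) this pq dpq(3)]
      have "free k ?E1 (c({p, z} := a)) q a" using rec(3) ak by (simp add: free_def)
      moreover have "attachable k ?E1 v1 p q U1" using that(1) at1 at1' by auto
      ultimately have "\<exists>c'. lin_coloring k (?E1 \<union> star v1 (insert p (insert q U1))) c'"
        using attach_vertex[OF k rec(1) _ rec(2)] that(5) by blast
      then show ?thesis using that(1) E by auto
    qed
    \<comment> \<open>There are at least six neighbors, and at most four are excluded:
      \<open>v1\<close>, two in \<open>B\<close>, and one along an edge of color
      \<open>a\<close>.\<close>
    have pick: "\<exists>w\<in>neighbors E p. w \<noteq> v1 \<and> w \<notin> B \<and> c {p, w} \<noteq> a"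
      if "p \<in> {x, y}" "finite B" "card B \<le> 2" for p B
    proof (rule ccontr)
      let ?A = "neighbors (color_class ?E1 c a) p"
      assume "\<not> ?thesis"
      moreover have "p \<noteq> v1" using that(1) nb[OF xv1] nb[OF y(2)] by auto
      ultimately have sub: "neighbors E p \<subseteq> insert v1 (B \<union> ?A)"
        by (auto simp: neighbors_def color_class_def del_vertex_def)
      have sc: "simple_graph V (color_class ?E1 c a)"
        by (rule simple_graph_subset[OF simple]) (auto simp: color_class_def del_vertex_def)
      have "card ?A \<le> 1" using degree_eq_card_neighbors[OF sc, of p] da that(1) by auto
      then have "card (insert v1 (B \<union> ?A)) \<le> 4"
        using that(3) card_Un_le[of B ?A] card_insert_le_m1[of 4 "B \<union> ?A" v1] by simp
      moreover have "card (neighbors E p) \<le> card (insert v1 (B \<union> ?A))"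
        using sub that(2) finite_neighbors[OF sc finc] by (intro card_mono) auto
      moreover have "card (neighbors E p) \<ge> 6"
        using degx degy k that(1) degree_eq_card_neighbors[OF simple, of p] by auto
      ultimately show False by linarith
    qed
    obtain v2 where v2: "v2 \<in> neighbors E x" "v2 \<noteq> v1" "v2 \<notin> neighbors E x - light E" "c {x, v2} \<noteq> a"
      using pick[of x "neighbors E x - light E"] x(1) finite_neighbors[OF simple fin] by auto
    then have light2: "v2 \<in> light E" by blast
    consider "v2 \<in> low E" | "v2 \<notin> low E" "v2 \<in> neighbors E v1" | "v2 \<notin> neighbors E v1" by blast
    then show ?thesis
    proof cases
      case 1
      then show ?thesis using recolor[of x y v2] v2 by blast
    next
      case 2
      \<comment> \<open>All neighbors of \<open>v1\<close> except \<open>x\<close> and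
        \<open>y\<close> are low. Hence \<open>y\<close> is light, and \<open>pick\<close> finds a
        low neighbor of \<open>y\<close> to recolor instead.\<close>
      then have "v2 = y" using y(3) nb[OF v2(1)] by blast
      then have "card (neighbors E y - low E) \<le> 2" using light2 by (simp add: light_def)
      then obtain z where "z \<in> neighbors E y" "z \<noteq> v1" "z \<notin> neighbors E y - low E" "c {y, z} \<noteq> a"
        using pick[of y "neighbors E y - low E"] finite_neighbors[OF simple fin] by auto
      then show ?thesis using recolor[of y x z] by blast
    next
      case 3
      let ?E0 = "del_vertex ?E1 v2"
      have simple1: "simple_graph V ?E1" by (rule simple_graph_subset[OF simple del_vertex_subset])
      have fin1: "finite ?E1" using fin del_vertex_subset finite_subset by metis
      have sub0: "?E0 \<subseteq> ?E1" by (rule del_vertex_subset)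
      have xv2: "x \<in> neighbors E v2" using v2(1) neighbors_sym by metis
      have v12: "v1 \<notin> neighbors E v2" using 3 neighbors_sym by metis
      obtain y2 where y2: "y2 \<noteq> x" "y2 \<in> neighbors E v2" "neighbors E v2 - {x, y2} \<subseteq> low E"
        using light_second_neighbor[OF simple fin light2 _ xv2 x(2)] nb[OF xv2] by blast
      define U2 where "U2 = neighbors E v2 - {x, y2}"
      have N2: "neighbors ?E1 v2 = neighbors E v2" "neighbors E v2 = insert x (insert y2 U2)"
        using v12 neighbors_del_vertex[OF v2(2)] xv2 y2(2) by (auto simp: U2_def)
      have "?E1 = ?E0 \<union> star v2 (insert x (insert y2 U2))"
        using del_vertex_Un_star[OF simple1, of v2] N2 by simp
      then have E0: "?E0 \<union> star v1 (insert x (insert y U1)) \<union> star v2 (insert x (insert y2 U2)) = E"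
        using E(1) by auto
      have deg0: "degree ?E0 u \<le> 1" if "u \<in> low E" "u \<in> neighbors E v1 \<or> u \<in> neighbors E v2" for u
      proof -
        have "degree ?E0 u \<le> degree (del_vertex E v) u" if "v = v1 \<or> v = v2" for v
          using that fin finite_subset[OF del_vertex_subset fin] by (intro degree_mono) (auto simp: del_vertex_def)
        then have "degree ?E0 u \<le> degree (del_vertex E v1) u" "degree ?E0 u \<le> degree (del_vertex E v2) u"
          by blast+
        then show ?thesis using leaf[of u v1] leaf[of u v2] that by fastforce
      qed
      have at1: "attachable k ?E0 v1 x y U1"
        using at1 deg0 y(3) by (auto simp: attachable_def U1_def del_vertex_def)
      have at2: "attachable k ?E0 v2 x y2 U2"
        using y2 xv2 nb[OF xv2] nb[OF y2(2)] cardU[OF y2(1)[symmetric] xv2 y2(2)] deg0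
          finite_neighbors[OF simple fin] nb[of v2 v2]
        by (auto simp: attachable_def U2_def del_vertex_def)
      \<comment> \<open>A low common neighbor of \<open>v1\<close> and \<open>v2\<close> has lost
        both of its edges.\<close>
      have common: "degree ?E0 u = 0"
        if "u \<in> insert y U1" "u \<in> insert y2 U2" "u \<in> U1 \<union> U2" for u
      proof -
        have "u \<in> neighbors E v1" "u \<in> neighbors ?E1 v2" using that N1 N2 by auto
        moreover have "degree E u \<le> 2" using that(3) y(3) y2(3) by (auto simp: U1_def U2_def low_def)
        ultimately show ?thesis
          using degree_del_vertex[OF simple fin, of u v1] degree_del_vertex[OF simple1 fin1, of u v2] by simp
      qed
      have e2: "{x, v2} \<in> ?E1" "{y2, v2} \<in> ?E1" "?E0 \<subseteq> ?E1 - {{x, v2}}" "?E0 \<subseteq> ?E1 - {{y2, v2}}"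
      proof -
        have "x \<in> neighbors ?E1 v2" "y2 \<in> neighbors ?E1 v2" using N2 by auto
        then show "{x, v2} \<in> ?E1" "{y2, v2} \<in> ?E1" by (simp_all add: neighbors_def insert_commute)
      qed (auto simp: del_vertex_def)
      \<comment> \<open>The deleted edge \<open>{y2, v2}\<close> was the only edge of color
        \<open>a\<close> at \<open>y\<close>.\<close>
      have yy: "degree (color_class ?E0 c a) y = 0" if "y = y2" "a = c {y2, v2}"
        using degree_color_class_removed[OF col e2(2) _ e2(4), of y] that da(2) by simp
      have out: "v1 \<notin> insert y2 U2" "v2 \<notin> insert y U1" using 3 v12 N1 N2(2) by auto
      have "free k ?E0 c x (c {x, v2})" "free k ?E0 c y2 (c {y2, v2})"
        using free_removed[OF col e2(1) _ e2(3), of x] free_removed[OF col e2(2) _ e2(4), of y2] by simp_all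
      \<comment> \<open>At \<open>x\<close> the two free colors are \<open>a\<close> and the old
        color of \<open>{x, v2}\<close>; \<open>y\<close> uses \<open>a\<close>, and
        \<open>y2\<close> the old color of \<open>{y2, v2}\<close>.\<close>
      then have "\<exists>c'. lin_coloring k (?E0 \<union> star v1 (insert x (insert y U1)) \<union> star v2 (insert x (insert y2 U2))) c'"
        by (intro attach_two_vertices[OF k lin_coloring_subset[OF col sub0] at1 at2 v2(2)[symmetric] out common yy
              free_subset[OF col a sub0] _ free_subset[OF col ya sub0] _ v2(4)[symmetric]])
      then show ?thesis unfolding E0 .
    qed
  qed
qed

section \<open>Degeneracy and the induction on the number of vertices\<close>

lemma degenerate_subgraph:
  assumes "degenerate d V E" "V' \<subseteq> V" "E' \<subseteq> E"
  shows "degenerate d V' E'"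
proof -
  have "subgraph V'' E'' V E" if "subgraph V'' E'' V' E'" for V'' E''
    using that assms(2,3) by (auto simp: subgraph_def)
  then show ?thesis using assms(1) by (simp add: degenerate_def)
qed

text \<open>Degeneracy is applied to the subgraph induced by \<open>W\<close>.\<close>

lemma degenerate_obtain:
  assumes "degenerate d V E" "simple_graph V E" "W \<subseteq> V" "W \<noteq> {}"
  obtains w where "w \<in> W" "card (neighbors E w \<inter> W) \<le> d"
proof -
  let ?F = "{e \<in> E. e \<subseteq> W}"
  have F: "simple_graph W ?F" using assms(2) by (auto simp: simple_graph_def)
  then have "subgraph W ?F V E" using assms(3) by (auto simp: subgraph_def)
  then obtain w where w: "w \<in> W" "degree ?F w \<le> d"
    using assms(1,4) by (auto simp: degenerate_def)
  have "neighbors ?F w = neighbors E w \<inter> W" using w(1) by (auto simp: neighbors_def)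
  then show ?thesis using that w degree_eq_card_neighbors[OF F, of w] by simp
qed

lemma lin_coloring_exists:
  assumes "k \<ge> 3" "finite V" "simple_graph V E" "degenerate 2 V E" "\<And>v. degree E v \<le> 2 * k"
  shows "\<exists>c. lin_coloring k E c"
  using assms(2-)
proof (induction "card V" arbitrary: V E rule: less_induct)
  case less
  note simple = less.prems(2)
  have "E \<subseteq> Pow V" using simple by (auto simp: simple_graph_def)
  then have fin: "finite E" using less.prems(1) by (simp add: finite_subset)
  have nV: "neighbors E v \<subseteq> V" for v using simple by (auto simp: simple_graph_def neighbors_def)
  have IH: "\<exists>c. lin_coloring k (del_vertex E v) c" if "v \<in> V" for v
  proof (rule less.hyps)
    show "card (V - {v}) < card V" using that less.prems(1) by (rule card_Diff1_less[rotated])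
    show "simple_graph (V - {v}) (del_vertex E v)" using simple by (auto simp: simple_graph_def del_vertex_def)
    show "degenerate 2 (V - {v}) (del_vertex E v)"
      using less.prems(3) by (rule degenerate_subgraph) (auto simp: del_vertex_def)
    show "degree (del_vertex E v) w \<le> 2 * k" for w
      using degree_mono[OF fin del_vertex_subset] less.prems(4) le_trans by blast
  qed (use less.prems(1) in simp)
  show ?case
  proof (cases "\<exists>v\<in>V. degree E v \<le> 1")
    case True
    then obtain v where v: "v \<in> V" "degree E v \<le> 1" by blast
    obtain c where c: "lin_coloring k (del_vertex E v) c" using IH[OF v(1)] by blast
    have "card (neighbors E v) \<le> 1" using v degree_eq_card_neighbors[OF simple] by metis
    then consider "neighbors E v = {}" | w where "neighbors E v = {w}"
      using finite_neighbors[OF simple fin, of v] by (metis One_nat_def card_1_singletonE card_eq_0_iff le_SucE le_zero_eq)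
    then show ?thesis
    proof cases
      case 1
      then show ?thesis using c del_vertex_Un_star[OF simple, of v] by auto
    next
      case (2 w)
      then have E: "E = insert {v, w} (del_vertex E v)" using del_vertex_Un_star[OF simple, of v] by simp
      have w: "w \<in> neighbors E v" "v \<noteq> w" using 2 simple_edge_neq[OF simple, of v w] by (auto simp: neighbors_def)
      have "degree (del_vertex E v) w < 2 * k"
        using degree_del_vertex[OF simple fin w(1)] less.prems(4)[of w] by simp
      then obtain i where i: "free k (del_vertex E v) c w i" using free_exists[OF c] by blast
      have "{e \<in> color_class (del_vertex E v) c i. v \<in> e} = {}" by (auto simp: color_class_def del_vertex_def)
      then have d: "degree (color_class (del_vertex E v) c i) v = 0" unfolding degree_def by (simp only: card.empty)
      then have "\<not> conn (color_class (del_vertex E v) c i) v w"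
        using conn_degree[OF lin_forest_finite[OF lin_coloring_class[OF c]], of i v w] w(2) by auto
      then have "lin_coloring k (insert {v, w} (del_vertex E v)) (c({v, w} := i))"
        using i w(2) d by (intro lin_coloring_add_edge[OF c]) (auto simp: free_def del_vertex_def)
      then show ?thesis using E by auto
    qed
  next
    case False
    have out: "degree E w = 0" if "w \<notin> V" for w
    proof -
      have "{e \<in> E. w \<in> e} = {}" using that simple by (auto simp: simple_graph_def)
      then show ?thesis unfolding degree_def by (simp only: card.empty)
    qed
    have min: "degree E w \<ge> 2" if "degree E w \<noteq> 0" for w
    proof -
      have "w \<in> V" using out[of w] that by argo
      with False have "\<not> degree E w \<le> 1" by simp
      then show ?thesis by linarith
    qed
    show ?thesis
    proof (cases "V = {}")
      case True
      then have "E = {}" using simple by (auto simp: simple_graph_def)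
      then show ?thesis by (auto simp: lin_coloring_def color_class_def lin_forest_empty)
    next
      case V: False
      have low_light: "low E \<subseteq> light E"
      proof
        fix v assume "v \<in> low E"
        then have "card (neighbors E v) \<le> 2" using degree_eq_card_neighbors[OF simple, of v] by (simp add: low_def)
        then show "v \<in> light E"
          using card_mono[OF finite_neighbors[OF simple fin, of v], of "neighbors E v - low E"] by (auto simp: light_def)
      qed
      have low_out: "v \<in> low E" if "v \<notin> V" for v using out[OF that] by (simp add: low_def)
      \<comment> \<open>If some vertex is not light, degeneracy of the graph on such vertices
        provides \<open>x\<close>, which is then not low. If all are light, any vertex that is not
        low serves, and if all are low, any vertex at all.\<close>
      obtain x where x: "x \<in> V" "card (neighbors E x - light E) \<le> 2" "x \<notin> low E \<or> low E = UNIV"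
      proof (cases "V \<subseteq> light E")
        case True
        then have z: "neighbors E v - light E = {}" for v using nV by blast
        show ?thesis
        proof (cases "V \<subseteq> low E")
          case True
          then have "low E = UNIV" using low_out by blast
          with V show ?thesis using that z by (metis all_not_in_conv card.empty zero_le)
        next
          case False
          with that z show ?thesis by (metis card.empty subsetI zero_le)
        qed
      next
        case False
        then obtain x where x: "x \<in> V - light E" "card (neighbors E x \<inter> (V - light E)) \<le> 2"
          using degenerate_obtain[OF less.prems(3) simple, of "V - light E"] by blast
        have "neighbors E x \<inter> (V - light E) = neighbors E x - light E" using nV by blast
        with x low_light that show ?thesis by auto
      qed
      \<comment> \<open>Without light neighbors, \<open>x\<close> would have at most two neighbors
        and thus be low. Then all vertices would be low, hence light, leaving \<open>x\<close>
        isolated against the minimum degree 2.\<close>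
      have "\<not> neighbors E x \<subseteq> neighbors E x - light E"
      proof
        assume *: "neighbors E x \<subseteq> neighbors E x - light E"
        then have eq: "neighbors E x - light E = neighbors E x" by blast
        then have "x \<in> low E" using x(2) degree_eq_card_neighbors[OF simple, of x] by (simp add: low_def)
        then have "neighbors E x = {}" using x(3) low_light * by blast
        then have "degree E x = 0" using degree_eq_card_neighbors[OF simple, of x] by simp
        then show False using False x(1) by force
      qed
      then obtain v where v: "v \<in> neighbors E x" "v \<in> light E" by blast
      then obtain c where "lin_coloring k (del_vertex E v) c" using IH nV by blast
      then show ?thesis
        using extend_at_light_vertex[OF assms(1) simple fin less.prems(4) min x(2,3) v] by blast
    qed
  qed
qed

theorem theorem2:
  fixes k :: nat and V :: "'a set" and E :: "'a set set"
  assumes "k \<ge> 3"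
    and "finite V"
    and "simple_graph V E"
    and "degenerate 2 V E"
    and "max_degree V E \<le> 2 * k"
  shows "linear_arboricity V E \<le> k"
proof -
  have "degree E v \<le> 2 * k" for v
  proof (cases "v \<in> V")
    case True
    then have "degree E v \<le> max_degree V E"
      unfolding max_degree_def using assms(2) by (intro Max_ge) auto
    with assms(5) show ?thesis by simp
  next
    case False
    then have "{e \<in> E. v \<in> e} = {}" using assms(3) by (auto simp: simple_graph_def)
    then show ?thesis unfolding degree_def by (simp only: card.empty)
  qed
  then obtain c where c: "lin_coloring k E c" using lin_coloring_exists[OF assms(1-4)] by blast
  have "linear_forest V {e \<in> E. c e = i}" for i
    using lin_coloring_class[OF c, of i] simple_graph_subset[OF assms(3), of "{e \<in> E. c e = i}"]
    by (intro lin_forest_linear_forest) (auto simp: color_class_def)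
  with c have "linear_coloring k V E c" by (simp add: linear_coloring_def lin_coloring_def)
  then show ?thesis unfolding linear_arboricity_def by (intro Least_le) blast
qed

end
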